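(* Let $R>0$, $K>0$, and for a codebook $\mathcal{C}_n$ of block length $n$ with $\lfloor e^{nR}\rfloor$ codewords let $P_e(\mathcal{C}_n)$ be the error probability of the maximum-likelihood decoder averaged over the equiprobable messages and the random channel instances. Then \[ \liminf_{n\to\infty}\ \min_{\mathcal{C}_n} -\tfrac1n\log\big[1-P_e(\mathcal{C}_n)\big]\ \ge\ E_c(R,K) \] for all $(R,K)$, and \[ \limsup_{n\to\infty}\ \max_{\mathcal{C}_n} -\tfrac1n\log P_e(\mathcal{C}_n)\ \le\ E_e(R,K) \] for every $(R,K)$ except possibly those $R$ at which the (monotonically non-increasing) function $R'\mapsto E_e(R',K)$ jumps from $+\infty$ to a finite value. Here \[ E_c(R,K)=\min_{PU}\Big\{D(U\|W|P)+\big|R-I_{PU}-|B_{PU}-K|^{+}\big|^{+}\Big\},\qquad E_e(R,K)=\max_P\ \min_{U:\ I_{PU}+|B_{PU}-K|^{+}\le R} D(U\|W|P). \]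
   Context: Channel model: $\mathcal{X},\mathcal{Y}$ finite alphabets, $W(y|x)$ a fixed conditional distribution. A codebook $\mathcal{C}_n$ consists of $\lfloor e^{nR}\rfloor$ codewords $\mathbf{x}_m\in\mathcal{X}^n$. A channel instance: independently for each message $m$, a cloud of $\lfloor e^{nK}\rfloor$ independent sequences $\mathbf{y}\in\mathcal{Y}^n$ whose letters are independent with $y_i\sim W(\cdot|x_{m,i})$. Messages are equiprobable; when $m$ is sent, the output is a uniformly chosen vector of the cloud of $m$. The decoder knows codebook and clouds; the ML decoder outputs a message whose cloud contains the most copies of the received vector (ties broken at random). Logs are natural. $P$ ranges over distributions on $\mathcal{X}$ and $U(y|x)$ over conditional distributions; $PU$ denotes the joint distribution $P(x)U(y|x)$. $D(U\|W|P)=\sum_{x,y}P(x)U(y|x)\log\frac{U(y|x)}{W(y|x)}$; $I_{PU}$ is the mutual information between $X$ and $Y$ under $PU$; $B_{PU}=\mathbb{E}_{PU}[-\log W(Y|X)]$; $|t|^{+}=\max\{0,t\}$; a minimum over an empty set is $+\infty$. *)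

theory Defs
  imports Complex_Main "HOL-Library.Extended_Real" "HOL-Library.Liminf_Limsup" "HOL-Library.FuncSet"
begin

definition is_dist :: "('a::finite \<Rightarrow> real) \<Rightarrow> bool" where
  "is_dist P \<longleftrightarrow> (\<forall>a. P a \<ge> 0) \<and> (\<Sum>a\<in>UNIV. P a) = 1"

definition is_channel :: "('a::finite \<Rightarrow> 'b::finite \<Rightarrow> real) \<Rightarrow> bool" where
  "is_channel U \<longleftrightarrow> (\<forall>x. is_dist (U x))"

definition chan_n :: "('a \<Rightarrow> 'b \<Rightarrow> real) \<Rightarrow> 'a list \<Rightarrow> 'b list \<Rightarrow> real" where
  "chan_n W xs ys = (\<Prod>i<length xs. W (xs ! i) (ys ! i))"

definition num_msgs :: "nat \<Rightarrow> real \<Rightarrow> nat" where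
  "num_msgs n R = nat \<lfloor>exp (real n * R)\<rfloor>"

definition codebooks :: "nat \<Rightarrow> nat \<Rightarrow> (nat \<Rightarrow> 'a list) set" where
  "codebooks n M = Pi\<^sub>E {..<M} (\<lambda>_. {xs. length xs = n})"

text \<open>Channel instances: for each message a cloud of \<open>L\<close> output sequences.\<close>
definition instances :: "nat \<Rightarrow> nat \<Rightarrow> nat \<Rightarrow> (nat \<Rightarrow> nat \<Rightarrow> 'b list) set" where
  "instances n M L = Pi\<^sub>E {..<M} (\<lambda>_. Pi\<^sub>E {..<L} (\<lambda>_. {ys. length ys = n}))"

definition inst_prob :: "('a \<Rightarrow> 'b \<Rightarrow> real) \<Rightarrow> nat \<Rightarrow> nat \<Rightarrow> (nat \<Rightarrow> 'a list)
    \<Rightarrow> (nat \<Rightarrow> nat \<Rightarrow> 'b list) \<Rightarrow> real" where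
  "inst_prob W M L c Y = (\<Prod>m<M. \<Prod>l<L. chan_n W (c m) (Y m l))"

definition copies :: "nat \<Rightarrow> (nat \<Rightarrow> nat \<Rightarrow> 'b list) \<Rightarrow> nat \<Rightarrow> 'b list \<Rightarrow> nat" where
  "copies L Y m y = card {l \<in> {..<L}. Y m l = y}"

definition ml_set :: "nat \<Rightarrow> nat \<Rightarrow> (nat \<Rightarrow> nat \<Rightarrow> 'b list) \<Rightarrow> 'b list \<Rightarrow> nat set" where
  "ml_set M L Y y = {m \<in> {..<M}. \<forall>m'\<in>{..<M}. copies L Y m' y \<le> copies L Y m y}"

text \<open>Probability that the ML decoder (random tie-breaking) outputs \<open>m\<close>.\<close>
definition ml_correct :: "nat \<Rightarrow> nat \<Rightarrow> (nat \<Rightarrow> nat \<Rightarrow> 'b list) \<Rightarrow> nat \<Rightarrow> 'b list \<Rightarrow> real" where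
  "ml_correct M L Y m y =
     (if m \<in> ml_set M L Y y then 1 / real (card (ml_set M L Y y)) else 0)"

text \<open>Error probability of the ML decoder, averaged over equiprobable messages,
  uniformly chosen cloud element, and random channel instances.\<close>
definition err_prob :: "('a \<Rightarrow> 'b::finite \<Rightarrow> real) \<Rightarrow> nat \<Rightarrow> real \<Rightarrow> real \<Rightarrow> (nat \<Rightarrow> 'a list) \<Rightarrow> real" where
  "err_prob W n R K c =
     (let M = num_msgs n R; L = num_msgs n K in
      1 - (1 / real M) * (\<Sum>m<M. (1 / real L) * (\<Sum>j<L.
             \<Sum>Y\<in>instances n M L. inst_prob W M L c Y * ml_correct M L Y m (Y m j))))"

definition neglog_rate :: "nat \<Rightarrow> real \<Rightarrow> ereal" where
  "neglog_rate n p = (if p = 0 then \<infinity> else ereal (- ln p / real n))"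

definition posp :: "ereal \<Rightarrow> ereal" where
  "posp t = max 0 t"

definition cond_div :: "('a::finite \<Rightarrow> 'b::finite \<Rightarrow> real) \<Rightarrow> ('a \<Rightarrow> 'b \<Rightarrow> real) \<Rightarrow> ('a \<Rightarrow> real) \<Rightarrow> ereal" where
  "cond_div U W P = (\<Sum>x\<in>UNIV. \<Sum>y\<in>UNIV.
      if P x * U x y = 0 then 0
      else if W x y = 0 then \<infinity>
      else ereal (P x * U x y * ln (U x y / W x y)))"

definition out_dist :: "('a::finite \<Rightarrow> real) \<Rightarrow> ('a \<Rightarrow> 'b \<Rightarrow> real) \<Rightarrow> 'b \<Rightarrow> real" where
  "out_dist P U y = (\<Sum>x\<in>UNIV. P x * U x y)"

definition mut_inf :: "('a::finite \<Rightarrow> real) \<Rightarrow> ('a \<Rightarrow> 'b::finite \<Rightarrow> real) \<Rightarrow> real" where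
  "mut_inf P U = (\<Sum>x\<in>UNIV. \<Sum>y\<in>UNIV.
      if P x * U x y = 0 then 0
      else P x * U x y * ln (U x y / out_dist P U y))"

definition B_val :: "('a::finite \<Rightarrow> real) \<Rightarrow> ('a \<Rightarrow> 'b::finite \<Rightarrow> real) \<Rightarrow> ('a \<Rightarrow> 'b \<Rightarrow> real) \<Rightarrow> ereal" where
  "B_val P U W = (\<Sum>x\<in>UNIV. \<Sum>y\<in>UNIV.
      if P x * U x y = 0 then 0
      else if W x y = 0 then \<infinity>
      else ereal (P x * U x y * - ln (W x y)))"

definition E_c :: "('a::finite \<Rightarrow> 'b::finite \<Rightarrow> real) \<Rightarrow> real \<Rightarrow> real \<Rightarrow> ereal" where
  "E_c W R K = (INF PU \<in> {(P, U). is_dist P \<and> is_channel U}.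
      cond_div (snd PU) W (fst PU)
      + posp (ereal R - ereal (mut_inf (fst PU) (snd PU))
              - posp (B_val (fst PU) (snd PU) W - ereal K)))"

definition E_e :: "('a::finite \<Rightarrow> 'b::finite \<Rightarrow> real) \<Rightarrow> real \<Rightarrow> real \<Rightarrow> ereal" where
  "E_e W R K = (SUP P \<in> {P. is_dist P}.
      INF U \<in> {U. is_channel U \<and> ereal (mut_inf P U) + posp (B_val P U W - ereal K) \<le> ereal R}.
        cond_div U W P)"

definition jump_point :: "('a::finite \<Rightarrow> 'b::finite \<Rightarrow> real) \<Rightarrow> real \<Rightarrow> real \<Rightarrow> bool" where
  "jump_point W K R \<longleftrightarrow>
     (\<forall>R'<R. E_e W R' K = \<infinity>) \<and> (\<forall>R'>R. E_e W R' K < \<infinity>)"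

end

theory Submission
  imports Defs
begin

text \<open>
  Let \<open>N\<^sub>m(y)\<close> be the number of copies of \<open>y\<close> in the cloud of \<open>m\<close>. It is binomial with \<open>L\<close> trials and
  success probability \<open>W(y|x\<^sub>m)\<close>, and the probability of correct decoding is
  \<open>(1 / (M L)) \<Sum>\<^sub>y E[max\<^sub>m N\<^sub>m(y)]\<close>. Over any set of messages whose success probabilities are at most
  \<open>p\<close>, the expected maximum is at most \<open>ln M + 2 L p\<close>, and also at most the sum of the means.

  For the correct-decoding exponent, the maximum is split according to the joint type \<open>PU\<close> of
  \<open>(x\<^sub>m, y)\<close>. Bounding by the sum of the means gives \<open>exp(-n D(U||W|P))\<close>; bounding by \<open>ln M + 2 L p\<close> for
  each of the at most \<open>exp(n H(Y))\<close> possible \<open>y\<close> gives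
  \<open>exp(-n (D(U||W|P) + R - I - |B - K|\<^sup>+))\<close>. There are polynomially many joint types.

  For the error exponent, keep only the codewords of the most frequent type \<open>P\<close> and, for each of
  them, only the outputs typical under \<open>U\<close>. If \<open>I + |B - K|\<^sup>+ < R\<close>, then \<open>\<Sum>\<^sub>y (ln M + 2 L p)\<close> over the
  typical outputs is exponentially smaller than the expected total number of copies, which is
  about \<open>M L exp(-n D(U||W|P))\<close>; hence the losing copies alone have this order. The strict
  inequality is obtained from feasibility at \<open>R\<close> by mixing \<open>U\<close> with a channel that is feasible at a
  smaller rate, which exists away from the jump, and using convexity in \<open>U\<close>.
\<close>

section \<open>Product laws and types\<close>

lemma finite_seqs [simp]: "finite {ys :: 'b::finite list. length ys = n}"
  using finite_lists_length_eq[of "UNIV :: 'b set" n] by simp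

lemma sum_seqs_Suc:
  fixes f :: "'b::finite list \<Rightarrow> 'c::comm_monoid_add"
  shows "(\<Sum>ys | length ys = Suc n. f ys) = (\<Sum>b\<in>UNIV. \<Sum>ys | length ys = n. f (b # ys))"
proof -
  have "(\<Sum>b\<in>UNIV. \<Sum>ys | length ys = n. f (b # ys))
      = (\<Sum>p\<in>UNIV \<times> {ys. length ys = n}. f (fst p # snd p))"
    by (simp add: sum.cartesian_product case_prod_beta)
  also have "\<dots> = (\<Sum>ys | length ys = Suc n. f ys)"
    by (rule sum.reindex_bij_witness[of _ "\<lambda>ys. (hd ys, tl ys)" "\<lambda>p. fst p # snd p"])
       (auto simp: length_Suc_conv)
  finally show ?thesis ..
qed

lemma chan_n_Cons [simp]: "chan_n W (a # xs) (b # ys) = W a b * chan_n W xs ys"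
  by (simp add: chan_n_def prod.lessThan_Suc_shift del: prod.lessThan_Suc)

lemma chan_n_Nil [simp]: "chan_n W [] ys = 1"
  by (simp add: chan_n_def)

lemma channel_nonneg: "is_channel U \<Longrightarrow> 0 \<le> U a b"
  by (simp add: is_channel_def is_dist_def)

lemma channel_sum: "is_channel U \<Longrightarrow> (\<Sum>b\<in>UNIV. U a b) = 1"
  by (simp add: is_channel_def is_dist_def)

lemma channel_le_1: "is_channel U \<Longrightarrow> U a b \<le> 1"
  by (metis (no_types, lifting) UNIV_I channel_nonneg channel_sum finite member_le_sum)

lemma chan_n_nonneg: "is_channel U \<Longrightarrow> 0 \<le> chan_n U xs ys"
  by (simp add: chan_n_def channel_nonneg prod_nonneg)

lemma sum_chan_n:
  "is_channel U \<Longrightarrow> (\<Sum>ys | length ys = length xs. chan_n U xs ys) = 1"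
proof (induction xs)
  case Nil
  then show ?case by simp
next
  case (Cons a xs)
  then show ?case
    by (simp add: sum_seqs_Suc channel_sum flip: sum_distrib_left)
qed

lemma sum_chan_n_le_1:
  fixes U :: "'a::finite \<Rightarrow> 'b::finite \<Rightarrow> real"
  assumes "is_channel U" "A \<subseteq> {ys. length ys = length xs}"
  shows "sum (chan_n U xs) A \<le> 1"
proof -
  have "sum (chan_n U xs) A \<le> (\<Sum>ys | length ys = length xs. chan_n U xs ys)"
    by (rule sum_mono2) (use assms chan_n_nonneg[OF assms(1)] in auto)
  then show ?thesis
    using assms by (simp add: sum_chan_n)
qed

text \<open>Induction on the word. Both moments are proved together because the cross term in the
  second vanishes by the first; what remains is that variances of independent letters add.\<close>

lemma chan_n_moments:
  fixes U h :: "'a::finite \<Rightarrow> 'b::finite \<Rightarrow> real"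
  assumes U: "is_channel U" and h: "\<And>a. (\<Sum>b\<in>UNIV. U a b * h a b) = 0"
  shows "(\<Sum>ys | length ys = length xs. chan_n U xs ys * (\<Sum>i<length xs. h (xs ! i) (ys ! i))) = 0
    \<and> (\<Sum>ys | length ys = length xs. chan_n U xs ys * (\<Sum>i<length xs. h (xs ! i) (ys ! i))\<^sup>2)
      = (\<Sum>i<length xs. \<Sum>b\<in>UNIV. U (xs ! i) b * (h (xs ! i) b)\<^sup>2)"
proof (induction xs)
  case Nil
  then show ?case by simp
next
  case (Cons a xs)
  define S where "S = (\<lambda>ys. \<Sum>i<length xs. h (xs ! i) (ys ! i))"
  have IH1: "(\<Sum>ys | length ys = length xs. chan_n U xs ys * S ys) = 0"
    and IH2: "(\<Sum>ys | length ys = length xs. chan_n U xs ys * (S ys)\<^sup>2)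
      = (\<Sum>i<length xs. \<Sum>b\<in>UNIV. U (xs ! i) b * (h (xs ! i) b)\<^sup>2)"
    using Cons by (auto simp: S_def)
  have c: "(\<Sum>ys | length ys = length xs. chan_n U xs ys) = 1"
    by (rule sum_chan_n[OF U])
  have S: "(\<Sum>i<length (a # xs). h ((a # xs) ! i) ((b # ys) ! i)) = h a b + S ys" for b ys
    by (simp add: S_def sum.lessThan_Suc_shift del: sum.lessThan_Suc)
  have 1: "(\<Sum>ys | length ys = length xs. chan_n U (a # xs) (b # ys) * (h a b + S ys))
      = U a b * h a b" for b
  proof -
    have "(\<Sum>ys | length ys = length xs. chan_n U (a # xs) (b # ys) * (h a b + S ys))
      = U a b * (h a b * (\<Sum>ys | length ys = length xs. chan_n U xs ys)
         + (\<Sum>ys | length ys = length xs. chan_n U xs ys * S ys))"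
      by (simp add: sum_distrib_left sum.distrib[symmetric] algebra_simps)
    then show ?thesis by (simp add: c IH1)
  qed
  have 2: "(\<Sum>ys | length ys = length xs. chan_n U (a # xs) (b # ys) * (h a b + S ys)\<^sup>2)
      = U a b * (h a b)\<^sup>2 + U a b * (\<Sum>ys | length ys = length xs. chan_n U xs ys * (S ys)\<^sup>2)" for b
  proof -
    have "(\<Sum>ys | length ys = length xs. chan_n U (a # xs) (b # ys) * (h a b + S ys)\<^sup>2)
      = U a b * ((h a b)\<^sup>2 * (\<Sum>ys | length ys = length xs. chan_n U xs ys)
         + 2 * h a b * (\<Sum>ys | length ys = length xs. chan_n U xs ys * S ys)
         + (\<Sum>ys | length ys = length xs. chan_n U xs ys * (S ys)\<^sup>2))"
      by (simp add: sum_distrib_left sum.distrib[symmetric] algebra_simps power2_eq_square)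
    then show ?thesis unfolding c IH1 by (simp add: algebra_simps)
  qed
  show ?case
    unfolding list.size(4) add_Suc_right add_0_right sum_seqs_Suc
    unfolding S[simplified] S[unfolded list.size(4) add_Suc_right add_0_right]
    by (simp add: 1[simplified] 2[simplified] h sum.distrib channel_sum[OF U] IH2
          sum.lessThan_Suc_shift del: sum.lessThan_Suc flip: sum_distrib_right)
qed

text \<open>Chebyshev's inequality for letters that are independent but not identically distributed.
  The variance is replaced by the larger second moment of \<open>g\<close>, for which bounds uniform
  in the channel \<open>U\<close> are available later (\<open>var_bounds\<close>).\<close>

lemma chan_n_chebyshev:
  fixes U g :: "'a::finite \<Rightarrow> 'b::finite \<Rightarrow> real"
  assumes U: "is_channel U" and t: "t > 0"
  shows "(\<Sum>ys | length ys = length xs \<and>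
       t \<le> \<bar>(\<Sum>i<length xs. g (xs ! i) (ys ! i)) - (\<Sum>i<length xs. \<Sum>b\<in>UNIV. U (xs ! i) b * g (xs ! i) b)\<bar>.
       chan_n U xs ys) \<le> (\<Sum>i<length xs. \<Sum>b\<in>UNIV. U (xs ! i) b * (g (xs ! i) b)\<^sup>2) / t\<^sup>2"
proof -
  define \<mu> where "\<mu> = (\<lambda>a. \<Sum>b\<in>UNIV. U a b * g a b)"
  define h where "h = (\<lambda>a b. g a b - \<mu> a)"
  define S where "S = (\<lambda>ys. \<Sum>i<length xs. h (xs ! i) (ys ! i))"
  have Seq: "(\<Sum>i<length xs. g (xs ! i) (ys ! i)) - (\<Sum>i<length xs. \<Sum>b\<in>UNIV. U (xs ! i) b * g (xs ! i) b) = S ys" for ys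
    by (simp add: S_def h_def \<mu>_def sum_subtractf)
  have h0: "(\<Sum>b\<in>UNIV. U a b * h a b) = 0" for a
    unfolding h_def right_diff_distrib sum_subtractf sum_distrib_right[symmetric]
    by (simp add: channel_sum[OF U] \<mu>_def)
  have var: "(\<Sum>b\<in>UNIV. U a b * (h a b)\<^sup>2) \<le> (\<Sum>b\<in>UNIV. U a b * (g a b)\<^sup>2)" for a
  proof -
    have "(\<Sum>b\<in>UNIV. U a b * (g a b)\<^sup>2) = (\<Sum>b\<in>UNIV. U a b * (h a b)\<^sup>2 + 2 * \<mu> a * (U a b * h a b) + (\<mu> a)\<^sup>2 * U a b)"
      by (rule sum.cong) (simp_all add: h_def algebra_simps power2_eq_square)
    also have "\<dots> = (\<Sum>b\<in>UNIV. U a b * (h a b)\<^sup>2) + (\<mu> a)\<^sup>2"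
      by (simp add: sum.distrib h0 channel_sum[OF U] flip: sum_distrib_left)
    finally show ?thesis by simp
  qed
  have "t\<^sup>2 * (\<Sum>ys | length ys = length xs \<and> t \<le> \<bar>S ys\<bar>. chan_n U xs ys)
      \<le> (\<Sum>ys | length ys = length xs \<and> t \<le> \<bar>S ys\<bar>. chan_n U xs ys * (S ys)\<^sup>2)"
    unfolding sum_distrib_left
  proof (rule sum_mono)
    fix ys assume "ys \<in> {ys. length ys = length xs \<and> t \<le> \<bar>S ys\<bar>}"
    then have "t\<^sup>2 \<le> (S ys)\<^sup>2"
      using t by (simp add: abs_le_square_iff[symmetric])
    then show "t\<^sup>2 * chan_n U xs ys \<le> chan_n U xs ys * (S ys)\<^sup>2"
      using chan_n_nonneg[OF U, of xs ys] by (simp add: mult.commute mult_left_mono)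
  qed
  also have "\<dots> \<le> (\<Sum>ys | length ys = length xs. chan_n U xs ys * (S ys)\<^sup>2)"
    by (rule sum_mono2) (auto simp: chan_n_nonneg[OF U])
  also have "\<dots> = (\<Sum>i<length xs. \<Sum>b\<in>UNIV. U (xs ! i) b * (h (xs ! i) b)\<^sup>2)"
    using chan_n_moments[OF U h0, of xs] by (simp add: S_def)
  also have "\<dots> \<le> (\<Sum>i<length xs. \<Sum>b\<in>UNIV. U (xs ! i) b * (g (xs ! i) b)\<^sup>2)"
    by (intro sum_mono var)
  finally show ?thesis
    using t by (simp add: Seq field_simps)
qed

section \<open>Empirical distributions and types\<close>

definition emp :: "'a list \<Rightarrow> 'a \<Rightarrow> real" where
  "emp zs a = real (card {i. i < length zs \<and> zs ! i = a}) / real (length zs)"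

lemma sum_emp:
  fixes f :: "'a::finite \<Rightarrow> real"
  shows "(\<Sum>i<length zs. f (zs ! i)) = real (length zs) * (\<Sum>a\<in>UNIV. emp zs a * f a)"
proof (cases "zs = []")
  case False
  have "(\<Sum>i<length zs. f (zs ! i)) = (\<Sum>i<length zs. \<Sum>a\<in>UNIV. if zs ! i = a then f a else 0)"
    by simp
  also have "\<dots> = (\<Sum>a\<in>UNIV. \<Sum>i<length zs. if zs ! i = a then f a else 0)"
    by (rule sum.swap)
  also have "\<dots> = (\<Sum>a\<in>UNIV. real (card {i. i < length zs \<and> zs ! i = a}) * f a)"
    by (intro sum.cong refl) (simp add: sum.If_cases Int_def)
  also have "\<dots> = real (length zs) * (\<Sum>a\<in>UNIV. emp zs a * f a)"
    using False by (simp add: emp_def sum_distrib_left)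
  finally show ?thesis .
qed simp

lemma is_dist_emp:
  fixes zs :: "'a::finite list"
  assumes "zs \<noteq> []"
  shows "is_dist (emp zs)"
  using sum_emp[of "\<lambda>_. 1" zs] assms by (simp add: is_dist_def emp_def)

lemma emp_pos_iff: "0 < emp zs a \<longleftrightarrow> a \<in> set zs"
proof -
  have "finite {i. i < length zs \<and> zs ! i = a}" by simp
  then have "0 < card {i. i < length zs \<and> zs ! i = a} \<longleftrightarrow> a \<in> set zs"
    by (auto simp: card_gt_0_iff in_set_conv_nth)
  moreover have "a \<in> set zs \<Longrightarrow> length zs > 0" by auto
  ultimately show ?thesis by (auto simp: emp_def zero_less_divide_iff)
qed

definition types :: "nat \<Rightarrow> ('a \<Rightarrow> real) set" where
  "types n = emp ` {zs. length zs = n}"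

lemma finite_types [simp]: "finite (types n :: ('a::finite \<Rightarrow> real) set)"
  by (simp add: types_def)

text \<open>A type is determined by its letter counts, each between 0 and \<open>n\<close>. Later
  only the polynomial growth in \<open>n\<close> matters.\<close>

lemma card_types: "card (types n :: ('a::finite \<Rightarrow> real) set) \<le> (n + 1) ^ card (UNIV :: 'a set)"
proof -
  let ?F = "PiE UNIV (\<lambda>_. {..n}) :: ('a \<Rightarrow> nat) set"
  have "types n \<subseteq> (\<lambda>k a. real (k a) / real n) ` ?F"
  proof
    fix t :: "'a \<Rightarrow> real" assume "t \<in> types n"
    then obtain zs where zs: "length zs = n" "t = emp zs" by (auto simp: types_def)
    let ?k = "\<lambda>a. card {i. i < length zs \<and> zs ! i = a}"
    have "?k a \<le> card {..<n}" for a by (rule card_mono) (auto simp: zs)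
    then have "?k \<in> ?F" by auto
    moreover have "t = (\<lambda>a. real (?k a) / real n)" by (auto simp: zs emp_def)
    ultimately show "t \<in> (\<lambda>k a. real (k a) / real n) ` ?F"
      by (intro image_eqI[where x = ?k])
  qed
  then have "card (types n :: ('a \<Rightarrow> real) set) \<le> card ?F"
    by (intro surj_card_le) (auto intro: finite_PiE)
  also have "\<dots> = (n + 1) ^ card (UNIV :: 'a set)"
    by (simp add: card_PiE)
  finally show ?thesis .
qed

lemma sum_emp_zip:
  fixes f :: "'a::finite \<Rightarrow> 'b::finite \<Rightarrow> real"
  assumes "length ys = length xs"
  shows "(\<Sum>i<length xs. f (xs ! i) (ys ! i))
    = real (length xs) * (\<Sum>a\<in>UNIV. \<Sum>b\<in>UNIV. emp (zip xs ys) (a, b) * f a b)"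
  using sum_emp[of "\<lambda>(a, b). f a b" "zip xs ys"] assms
  by (simp add: sum.cartesian_product case_prod_beta)

lemma chan_n_exp_sum:
  assumes "\<And>i. i < length xs \<Longrightarrow> 0 < U (xs ! i) (ys ! i)"
  shows "chan_n U xs ys = exp (\<Sum>i<length xs. ln (U (xs ! i) (ys ! i)))"
  using assms by (simp add: chan_n_def exp_sum)

section \<open>The maximum-likelihood decoder\<close>

locale cloud_code =
  fixes W :: "'x::finite \<Rightarrow> 'y::finite \<Rightarrow> real" and n M L :: nat and c :: "nat \<Rightarrow> 'x list"
  assumes W: "is_channel W" and len: "\<And>m. m < M \<Longrightarrow> length (c m) = n"
    and M: "M > 0" and L: "L > 0"
begin

section \<open>Expectations over the random clouds\<close>

definition seqs :: "'y list set" where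
  "seqs = {ys. length ys = n}"

definition expect :: "((nat \<Rightarrow> nat \<Rightarrow> 'y list) \<Rightarrow> real) \<Rightarrow> real" where
  "expect F = (\<Sum>Y\<in>instances n M L. inst_prob W M L c Y * F Y)"

text \<open>Inserting 0 gives the empty set of messages the maximum 0 and changes no other value,
  since counts are nonnegative.\<close>

definition mx :: "nat set \<Rightarrow> 'y list \<Rightarrow> (nat \<Rightarrow> nat \<Rightarrow> 'y list) \<Rightarrow> real" where
  "mx A y Y = real (Max (insert 0 ((\<lambda>m. copies L Y m y) ` A)))"

lemma finite_seqs' [simp]: "finite seqs"
  by (simp add: seqs_def)

lemma inst_prob_nonneg: "0 \<le> inst_prob W M L c Y"
  by (simp add: inst_prob_def prod_nonneg chan_n_nonneg[OF W])

lemma expect_mono: "(\<And>Y. Y \<in> instances n M L \<Longrightarrow> F Y \<le> G Y) \<Longrightarrow> expect F \<le> expect G"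
  unfolding expect_def by (intro sum_mono mult_left_mono inst_prob_nonneg)

lemma expect_cong: "(\<And>Y. Y \<in> instances n M L \<Longrightarrow> F Y = G Y) \<Longrightarrow> expect F = expect G"
  by (simp add: expect_def)

lemma expect_add: "expect (\<lambda>Y. F Y + G Y) = expect F + expect G"
  by (simp add: expect_def sum.distrib distrib_left)

lemma expect_diff: "expect (\<lambda>Y. F Y - G Y) = expect F - expect G"
  by (simp add: expect_def sum_subtractf right_diff_distrib)

lemma expect_cmult: "expect (\<lambda>Y. a * F Y) = a * expect F"
  by (simp add: expect_def sum_distrib_left algebra_simps)

lemma expect_sum: "expect (\<lambda>Y. \<Sum>i\<in>I. F i Y) = (\<Sum>i\<in>I. expect (F i))"
  unfolding expect_def sum_distrib_left by (rule sum.swap)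

lemma sum_chan_n_codeword: "m < M \<Longrightarrow> (\<Sum>ys\<in>seqs. chan_n W (c m) ys) = 1"
  using sum_chan_n[OF W, of "c m"] len by (simp add: seqs_def)

lemma sum_cloud:
  "(\<Sum>Z\<in>PiE {..<L} (\<lambda>_. seqs). (\<Prod>l<L. chan_n W xs (Z l)) * (\<Prod>l<L. g l (Z l)))
    = (\<Prod>l<L. \<Sum>y\<in>seqs. chan_n W xs y * g l y)"
  by (subst prod_sum_PiE) (simp_all add: prod.distrib)

text \<open>A sum of products over a function space factorises, first over the messages and then
  over the cloud elements; every other cloud sums to 1. One cloud at a time is enough, since
  different messages are later combined by linearity.\<close>

lemma expect_cloud_prod:
  assumes m: "m < M"
  shows "expect (\<lambda>Y. \<Prod>l<L. g l (Y m l)) = (\<Prod>l<L. \<Sum>y\<in>seqs. chan_n W (c m) y * g l y)"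
proof -
  let ?C = "PiE {..<L} (\<lambda>_. seqs)"
  let ?f = "\<lambda>m' Z. (\<Prod>l<L. chan_n W (c m') (Z l)) * (\<Prod>l<L. if m' = m then g l (Z l) else 1)"
  have inst: "instances n M L = PiE {..<M} (\<lambda>_. ?C)"
    by (simp add: instances_def seqs_def)
  have fin: "finite ?C" by (intro finite_PiE) auto
  have "expect (\<lambda>Y. \<Prod>l<L. g l (Y m l)) = (\<Sum>Y\<in>instances n M L. \<Prod>m'<M. ?f m' (Y m'))"
    unfolding expect_def
  proof (rule sum.cong[OF refl])
    fix Y :: "nat \<Rightarrow> nat \<Rightarrow> 'y list"
    have "(\<Prod>m'<M. \<Prod>l<L. if m' = m then g l (Y m' l) else 1)
        = (\<Prod>m'<M. if m' = m then \<Prod>l<L. g l (Y m l) else 1)"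
      by (intro prod.cong) auto
    also have "\<dots> = (\<Prod>l<L. g l (Y m l))"
      using m by simp
    finally show "inst_prob W M L c Y * (\<Prod>l<L. g l (Y m l)) = (\<Prod>m'<M. ?f m' (Y m'))"
      by (simp add: inst_prob_def prod.distrib)
  qed
  also have "\<dots> = (\<Prod>m'<M. \<Sum>Z\<in>?C. ?f m' Z)"
    unfolding inst by (rule prod_sum_PiE[symmetric]) (auto simp: fin)
  also have "\<dots> = (\<Prod>m'<M. if m' = m then \<Prod>l<L. \<Sum>y\<in>seqs. chan_n W (c m) y * g l y else 1)"
  proof (rule prod.cong[OF refl])
    fix m' assume "m' \<in> {..<M}"
    then show "(\<Sum>Z\<in>?C. ?f m' Z) = (if m' = m then \<Prod>l<L. \<Sum>y\<in>seqs. chan_n W (c m) y * g l y else 1)"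
      using sum_cloud[of "c m'" "\<lambda>l y. if m' = m then g l y else 1"] sum_chan_n_codeword[of m']
      by (cases "m' = m") auto
  qed
  also have "\<dots> = (\<Prod>l<L. \<Sum>y\<in>seqs. chan_n W (c m) y * g l y)"
    using m by simp
  finally show ?thesis .
qed

lemma expect_1: "expect (\<lambda>_. 1) = 1"
  using expect_cloud_prod[OF M, of "\<lambda>_ _. 1"] sum_chan_n_codeword[OF M] by simp

lemma expect_const: "expect (\<lambda>_. a) = a"
  using expect_cmult[of a "\<lambda>_. 1"] by (simp add: expect_1)

lemma copies_eq_sum: "real (copies L Y m y) = (\<Sum>l<L. if Y m l = y then 1 else 0)"
  by (simp add: copies_def sum.If_cases Int_def)

lemma sum_indicator_seqs:
  "y \<in> seqs \<Longrightarrow> (\<Sum>z\<in>seqs. f z * (if z = y then 1 else 0)) = (f y :: real)"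
  by (simp add: if_distrib cong: if_cong)

lemma expect_copies:
  assumes m: "m < M" and y: "y \<in> seqs"
  shows "expect (\<lambda>Y. real (copies L Y m y)) = real L * chan_n W (c m) y"
proof -
  have "expect (\<lambda>Y. if Y m l = y then 1 else 0) = chan_n W (c m) y" if l: "l < L" for l
  proof -
    \<comment> \<open>The indicator for a single cloud element is written as a product over the
      whole cloud, with factor 1 elsewhere, so that \<open>expect_cloud_prod\<close>
      applies.\<close>
    let ?g = "\<lambda>l' z. if l' = l then if z = y then 1 else 0 else 1 :: real"
    have "(\<Prod>l'<L. ?g l' (Y m l')) = (if Y m l = y then 1 else 0)" for Y :: "nat \<Rightarrow> nat \<Rightarrow> 'y list"
      using l by simp
    then have "expect (\<lambda>Y. if Y m l = y then 1 else 0) = expect (\<lambda>Y. \<Prod>l'<L. ?g l' (Y m l'))"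
      by simp
    also have "\<dots> = (\<Prod>l'<L. \<Sum>z\<in>seqs. chan_n W (c m) z * ?g l' z)"
      by (rule expect_cloud_prod[OF m])
    also have "\<dots> = (\<Prod>l'<L. if l' = l then chan_n W (c m) y else 1)"
      by (intro prod.cong) (use sum_indicator_seqs[OF y] sum_chan_n_codeword[OF m] in auto)
    finally show ?thesis using l by simp
  qed
  then show ?thesis
    by (simp add: copies_eq_sum expect_sum)
qed

text \<open>The exponential of an indicator is affine in the indicator, so the moment generating
  function of the binomial count at 1 is (1 + (e - 1) p)^L. The bound follows from e - 1 <= 2 and 1
  + x <= exp x.\<close>

lemma expect_exp_copies:
  assumes m: "m < M" and y: "y \<in> seqs"
  shows "expect (\<lambda>Y. exp (real (copies L Y m y))) \<le> exp (2 * real L * chan_n W (c m) y)"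
proof -
  let ?p = "chan_n W (c m) y"
  let ?g = "\<lambda>z. 1 + (exp 1 - 1) * (if z = y then 1 else 0 :: real)"
  have "exp (real (copies L Y m y)) = (\<Prod>l<L. ?g (Y m l))" for Y
    unfolding copies_eq_sum exp_sum[OF finite_lessThan] by (rule prod.cong) auto
  then have "expect (\<lambda>Y. exp (real (copies L Y m y))) = (\<Prod>l<L. \<Sum>z\<in>seqs. chan_n W (c m) z * ?g z)"
    using expect_cloud_prod[OF m, of "\<lambda>_. ?g"] by simp
  also have "(\<Sum>z\<in>seqs. chan_n W (c m) z * ?g z) = 1 + (exp 1 - 1) * ?p"
  proof -
    have "(\<Sum>z\<in>seqs. chan_n W (c m) z * ?g z) = (\<Sum>z\<in>seqs. chan_n W (c m) z)
        + (exp 1 - 1) * (\<Sum>z\<in>seqs. chan_n W (c m) z * (if z = y then 1 else 0))"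
      unfolding sum_distrib_left sum.distrib[symmetric] by (intro sum.cong) (auto simp: algebra_simps)
    then show ?thesis
      by (simp only: sum_indicator_seqs[OF y] sum_chan_n_codeword[OF m])
  qed
  also have "(\<Prod>l<L. 1 + (exp 1 - 1) * ?p) = (1 + (exp 1 - 1) * ?p) ^ L" by simp
  also have "\<dots> \<le> exp (2 * ?p) ^ L"
  proof (rule power_mono)
    have p: "0 \<le> ?p" by (rule chan_n_nonneg[OF W])
    have "(exp 1 - 1) * ?p \<le> 2 * ?p"
      using exp_le p by (intro mult_right_mono) auto
    then show "1 + (exp 1 - 1) * ?p \<le> exp (2 * ?p)"
      using exp_ge_add_one_self[of "2 * ?p"] by linarith
    show "0 \<le> 1 + (exp 1 - 1) * ?p"
      using p by (intro add_nonneg_nonneg mult_nonneg_nonneg) auto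
  qed
  also have "\<dots> = exp (2 * real L * ?p)"
    by (simp add: exp_of_nat_mult[symmetric] algebra_simps)
  finally show ?thesis .
qed

section \<open>The largest number of copies in a set of clouds\<close>

lemma mx_ge: "finite A \<Longrightarrow> m \<in> A \<Longrightarrow> real (copies L Y m y) \<le> mx A y Y"
  by (simp add: mx_def)

lemma mx_nonneg: "0 \<le> mx A y Y"
  by (simp add: mx_def)

lemma mx_attained:
  assumes "finite A" "A \<noteq> {}"
  obtains m where "m \<in> A" "mx A y Y = real (copies L Y m y)"
proof -
  have "Max (insert 0 ((\<lambda>m. copies L Y m y) ` A)) = Max ((\<lambda>m. copies L Y m y) ` A)"
    using assms by (simp add: Max_insert)
  moreover have "Max ((\<lambda>m. copies L Y m y) ` A) \<in> (\<lambda>m. copies L Y m y) ` A"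
    using assms by (intro Max_in) auto
  ultimately show ?thesis using that by (auto simp: mx_def)
qed

lemma mx_le_sum: "finite A \<Longrightarrow> mx A y Y \<le> (\<Sum>m\<in>A. real (copies L Y m y))"
proof (cases "A = {}")
  case False
  assume "finite A"
  then obtain m where "m \<in> A" "mx A y Y = real (copies L Y m y)"
    using False by (rule mx_attained)
  then show ?thesis
    using member_le_sum[of m A "\<lambda>m. real (copies L Y m y)"] \<open>finite A\<close> by simp
qed (simp add: mx_def)

lemma expect_mx_le_sum:
  assumes "A \<subseteq> {..<M}" "y \<in> seqs"
  shows "expect (mx A y) \<le> real L * (\<Sum>m\<in>A. chan_n W (c m) y)"
proof -
  have fin: "finite A" using assms finite_subset by auto
  have "expect (mx A y) \<le> expect (\<lambda>Y. \<Sum>m\<in>A. real (copies L Y m y))"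
    by (intro expect_mono mx_le_sum fin)
  also have "\<dots> = (\<Sum>m\<in>A. real L * chan_n W (c m) y)"
    unfolding expect_sum by (rule sum.cong) (use assms in \<open>auto intro!: expect_copies\<close>)
  finally show ?thesis by (simp add: sum_distrib_left)
qed

text \<open>Jensen's inequality for \<open>max N \<le> ln (\<Sum> exp N)\<close>, with \<open>ln u \<le> u / v + ln v - 1\<close> in place of
  concavity.\<close>
lemma expect_mx_le_log:
  assumes A: "A \<subseteq> {..<M}" and y: "y \<in> seqs" and p: "\<And>m. m \<in> A \<Longrightarrow> chan_n W (c m) y \<le> p" and "0 \<le> p"
  shows "expect (mx A y) \<le> ln (real M) + 2 * real L * p"
proof (cases "A = {}")
  case True
  then have "expect (mx A y) = 0" by (simp add: mx_def expect_def)
  then show ?thesis using M \<open>0 \<le> p\<close> by simp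
next
  case False
  have fin: "finite A" using A finite_subset by auto
  \<comment> \<open>\<open>v\<close> bounds the expected sum of exponentials and \<open>ln v\<close>
    is the target. Using the tangent of \<open>ln\<close> at this very point, the terms E / v - 1
    contribute at most 0 and only \<open>ln v\<close> remains.\<close>
  define v where "v = real M * exp (2 * real L * p)"
  have v: "v > 0" using M by (simp add: v_def)
  have lnv: "ln v = ln (real M) + 2 * real L * p"
    using M by (simp add: v_def ln_mult)
  have "mx A y Y \<le> (1 / v) * (\<Sum>m\<in>A. exp (real (copies L Y m y))) + (ln v - 1)" for Y
  proof -
    obtain m where m: "m \<in> A" "mx A y Y = real (copies L Y m y)"
      using fin False by (rule mx_attained)
    have "ln (exp (mx A y Y) / v) \<le> exp (mx A y Y) / v - 1"
      using v by (intro ln_le_minus_one) auto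
    then have "mx A y Y \<le> exp (mx A y Y) / v + ln v - 1"
      using v by (simp add: ln_div)
    moreover have "exp (mx A y Y) \<le> (\<Sum>m\<in>A. exp (real (copies L Y m y)))"
      unfolding m(2) by (rule member_le_sum[OF m(1) _ fin]) simp
    then have "exp (mx A y Y) / v \<le> (\<Sum>m\<in>A. exp (real (copies L Y m y))) / v"
      using v by (simp add: divide_right_mono)
    ultimately show ?thesis by simp
  qed
  then have "expect (mx A y) \<le> expect (\<lambda>Y. (1 / v) * (\<Sum>m\<in>A. exp (real (copies L Y m y))) + (ln v - 1))"
    by (intro expect_mono)
  also have "\<dots> = (1 / v) * (\<Sum>m\<in>A. expect (\<lambda>Y. exp (real (copies L Y m y)))) + (ln v - 1)"
    by (simp only: expect_add expect_cmult expect_const expect_sum)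
  finally have le: "expect (mx A y)
      \<le> (1 / v) * (\<Sum>m\<in>A. expect (\<lambda>Y. exp (real (copies L Y m y)))) + (ln v - 1)" .
  have "(\<Sum>m\<in>A. expect (\<lambda>Y. exp (real (copies L Y m y)))) \<le> (\<Sum>m\<in>A. exp (2 * real L * p))"
  proof (rule sum_mono)
    fix m assume m: "m \<in> A"
    then have "expect (\<lambda>Y. exp (real (copies L Y m y))) \<le> exp (2 * real L * chan_n W (c m) y)"
      using A y by (intro expect_exp_copies) auto
    also have "\<dots> \<le> exp (2 * real L * p)"
      using p[OF m] by (simp add: mult_left_mono)
    finally show "expect (\<lambda>Y. exp (real (copies L Y m y))) \<le> exp (2 * real L * p)" .
  qed
  also have "\<dots> \<le> v"
  proof -
    have "card A \<le> M" using card_mono[OF _ A] by simp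
    then show ?thesis by (simp add: v_def)
  qed
  finally have "(1 / v) * (\<Sum>m\<in>A. expect (\<lambda>Y. exp (real (copies L Y m y)))) \<le> 1"
    using v by (simp add: divide_le_eq)
  then show ?thesis using lnv le by linarith
qed

section \<open>Success and error probabilities as expected counts\<close>

lemma expect_sum_copies:
  assumes "A \<subseteq> {..<M}" "y \<in> seqs"
  shows "expect (\<lambda>Y. \<Sum>m\<in>A. real (copies L Y m y)) = real L * (\<Sum>m\<in>A. chan_n W (c m) y)"
  unfolding expect_sum sum_distrib_left
  by (rule sum.cong) (use assms in \<open>auto intro!: expect_copies\<close>)

text \<open>Summing the decoder's success over the cloud elements equal to \<open>y\<close> leaves the number of copies
  in the winning cloud.\<close>
lemma sum_ml_correct:
  assumes Y: "Y \<in> instances n M L"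
  shows "(\<Sum>m<M. \<Sum>j<L. ml_correct M L Y m (Y m j)) = (\<Sum>y\<in>seqs. mx {..<M} y Y)"
proof -
  have "(\<Sum>j<L. ml_correct M L Y m (Y m j)) = (\<Sum>y\<in>seqs. real (copies L Y m y) * ml_correct M L Y m y)"
    if "m < M" for m
  proof -
    have "Y m j \<in> seqs" if "j < L" for j
      using Y that \<open>m < M\<close> by (auto simp: instances_def seqs_def PiE_def Pi_def)
    then have "(\<Sum>j<L. ml_correct M L Y m (Y m j))
        = (\<Sum>j<L. \<Sum>y\<in>seqs. (if Y m j = y then 1 else 0) * ml_correct M L Y m y)"
      by (intro sum.cong refl) (simp add: if_distrib[of "\<lambda>x. x * _"] cong: if_cong)
    also have "\<dots> = (\<Sum>y\<in>seqs. \<Sum>j<L. (if Y m j = y then 1 else 0) * ml_correct M L Y m y)"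
      by (rule sum.swap)
    finally show ?thesis by (simp add: copies_eq_sum sum_distrib_right)
  qed
  then have "(\<Sum>m<M. \<Sum>j<L. ml_correct M L Y m (Y m j))
      = (\<Sum>m<M. \<Sum>y\<in>seqs. real (copies L Y m y) * ml_correct M L Y m y)"
    by simp
  also have "\<dots> = (\<Sum>y\<in>seqs. \<Sum>m<M. real (copies L Y m y) * ml_correct M L Y m y)"
    by (rule sum.swap)
  also have "\<dots> = (\<Sum>y\<in>seqs. mx {..<M} y Y)"
  proof (rule sum.cong[OF refl])
    fix y
    let ?S = "ml_set M L Y y"
    obtain m where m: "m \<in> {..<M}" "mx {..<M} y Y = real (copies L Y m y)"
      by (rule mx_attained[of "{..<M}"]) (use M in auto)
    \<comment> \<open>All tied winners have the same, maximal count, so the uniform tie-breaking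
      weights add up to exactly one copy of the maximum.\<close>
    have S: "real (copies L Y m' y) = mx {..<M} y Y" if "m' \<in> ?S" for m'
      using that mx_ge[of "{..<M}" m' Y y] m
      by (auto simp: ml_set_def intro!: order_antisym)
    have "m \<in> ?S"
      using m mx_ge[of "{..<M}" _ Y y] by (auto simp: ml_set_def)
    then have "card ?S > 0" by (auto simp: card_gt_0_iff ml_set_def)
    have "(\<Sum>m<M. real (copies L Y m y) * ml_correct M L Y m y)
        = (\<Sum>m\<in>?S. real (copies L Y m y) * ml_correct M L Y m y)"
      by (rule sum.mono_neutral_right) (auto simp: ml_correct_def ml_set_def)
    also have "\<dots> = (\<Sum>m\<in>?S. mx {..<M} y Y * (1 / real (card ?S)))"
      by (rule sum.cong) (auto simp: S ml_correct_def)
    also have "\<dots> = mx {..<M} y Y"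
      using \<open>card ?S > 0\<close> by simp
    finally show "(\<Sum>m<M. real (copies L Y m y) * ml_correct M L Y m y) = mx {..<M} y Y" .
  qed
  finally show ?thesis .
qed

definition correct :: real where
  "correct = (\<Sum>y\<in>seqs. expect (mx {..<M} y)) / (real M * real L)"

lemma correct_eq:
  "(1 / real M) * (\<Sum>m<M. (1 / real L) * (\<Sum>j<L.
     \<Sum>Y\<in>instances n M L. inst_prob W M L c Y * ml_correct M L Y m (Y m j))) = correct"
proof -
  have "(\<Sum>m<M. \<Sum>j<L. expect (\<lambda>Y. ml_correct M L Y m (Y m j)))
      = expect (\<lambda>Y. \<Sum>m<M. \<Sum>j<L. ml_correct M L Y m (Y m j))"
    by (simp add: expect_sum)
  also have "\<dots> = expect (\<lambda>Y. \<Sum>y\<in>seqs. mx {..<M} y Y)"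
    by (intro expect_cong sum_ml_correct)
  finally show ?thesis
    by (simp add: expect_sum correct_def expect_def[symmetric] sum_distrib_left[symmetric]
        sum_divide_distrib[symmetric])
qed

text \<open>The expected number of copies, summed over all messages and outputs, is
  \<open>M * L\<close>. Subtracting the winning copies leaves the losing ones, which are the
  errors.\<close>

lemma one_minus_correct:
  "1 - correct = (\<Sum>y\<in>seqs. expect (\<lambda>Y. (\<Sum>m<M. real (copies L Y m y)) - mx {..<M} y Y)) / (real M * real L)"
proof -
  have "(\<Sum>y\<in>seqs. expect (\<lambda>Y. \<Sum>m<M. real (copies L Y m y))) = (\<Sum>y\<in>seqs. real L * (\<Sum>m<M. chan_n W (c m) y))"
    by (intro sum.cong expect_sum_copies) auto
  also have "\<dots> = real L * (\<Sum>m<M. \<Sum>y\<in>seqs. chan_n W (c m) y)"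
    by (simp add: sum_distrib_left[symmetric] sum.swap[of _ seqs])
  also have "\<dots> = real M * real L"
    by (simp add: sum_chan_n_codeword)
  finally show ?thesis
    using M L by (simp add: expect_diff sum_subtractf correct_def diff_divide_distrib)
qed

text \<open>Allows a lower bound on the losing copies to be computed from a subset of the messages.
  If \<open>b\<close> wins in \<open>B\<close>, then dropping \<open>b\<close> from \<open>A\<close>
  removes at most \<open>mx A\<close>, and what is left of \<open>A\<close> still loses in
  \<open>B\<close>.\<close>

lemma sum_copies_minus_mx_mono:
  assumes A: "A \<subseteq> B" "finite B"
  shows "(\<Sum>m\<in>A. real (copies L Y m y)) - mx A y Y \<le> (\<Sum>m\<in>B. real (copies L Y m y)) - mx B y Y"
proof (cases "B = {}")
  case False
  obtain b where b: "b \<in> B" "mx B y Y = real (copies L Y b y)"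
    using A(2) False by (rule mx_attained)
  have finA: "finite A" using A finite_subset by blast
  have "(\<Sum>m\<in>A. real (copies L Y m y)) - mx A y Y \<le> (\<Sum>m\<in>A - {b}. real (copies L Y m y))"
    using mx_ge[OF finA, of b Y y] mx_nonneg[of A y Y] finA
    by (cases "b \<in> A") (simp_all add: sum_diff1)
  also have "\<dots> \<le> (\<Sum>m\<in>B - {b}. real (copies L Y m y))"
    by (rule sum_mono2) (use A in auto)
  also have "\<dots> = (\<Sum>m\<in>B. real (copies L Y m y)) - mx B y Y"
    using b A(2) by (simp add: sum_diff1)
  finally show ?thesis .
qed (use A in simp)

end

lemma err_prob_eq:
  assumes "cloud_code W n (num_msgs n R) (num_msgs n K) c"
  shows "err_prob W n R K c = 1 - cloud_code.correct W n (num_msgs n R) (num_msgs n K) c"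
  unfolding err_prob_def Let_def cloud_code.correct_eq[OF assms] ..

text \<open>Rounding down a number that is at least 1 loses at most a factor 2, which is invisible
  in the exponents.\<close>

lemma num_msgs_bounds:
  assumes "R > 0"
  shows "0 < num_msgs n R" "exp (real n * R) / 2 \<le> real (num_msgs n R)"
    "real (num_msgs n R) \<le> exp (real n * R)"
proof -
  let ?z = "exp (real n * R)"
  have "?z \<ge> 1" using assms by simp
  then have 1: "\<lfloor>?z\<rfloor> \<ge> 1" by simp
  then have 2: "real (num_msgs n R) = of_int \<lfloor>?z\<rfloor>"
    by (simp add: num_msgs_def)
  show "0 < num_msgs n R" using 1 by (simp add: num_msgs_def)
  show "real (num_msgs n R) \<le> ?z" unfolding 2 by simp
  have "?z < of_int \<lfloor>?z\<rfloor> + 1" by simp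
  moreover have "(1::real) \<le> of_int \<lfloor>?z\<rfloor>" using 1 by linarith
  ultimately show "?z / 2 \<le> real (num_msgs n R)" unfolding 2 by linarith
qed

lemma cloud_code_codebooks:
  assumes "is_channel W" "R > 0" "K > 0" "c \<in> codebooks n (num_msgs n R)"
  shows "cloud_code W n (num_msgs n R) (num_msgs n K) c"
  using assms num_msgs_bounds(1)
  by unfold_locales (auto simp: codebooks_def PiE_def Pi_def)

section \<open>The correct-decoding exponent\<close>

definition mean :: "('a::finite \<Rightarrow> real) \<Rightarrow> ('a \<Rightarrow> 'b::finite \<Rightarrow> real) \<Rightarrow> ('a \<Rightarrow> 'b \<Rightarrow> real) \<Rightarrow> real" where
  "mean P U f = (\<Sum>a\<in>UNIV. \<Sum>b\<in>UNIV. P a * U a b * f a b)"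

text \<open>Separates the finite case: where this fails, the divergence and \<open>B_val\<close> are
  both infinite; where it holds, both are real means. Pairs of weight zero do not disturb these
  means, whatever value \<open>ln\<close> or division takes there.\<close>

definition abs_cont :: "('a::finite \<Rightarrow> real) \<Rightarrow> ('a \<Rightarrow> 'b::finite \<Rightarrow> real) \<Rightarrow> ('a \<Rightarrow> 'b \<Rightarrow> real) \<Rightarrow> bool" where
  "abs_cont P U W \<longleftrightarrow> (\<forall>a b. P a * U a b \<noteq> 0 \<longrightarrow> W a b \<noteq> 0)"

lemma mean_cong:
  "(\<And>a b. P a * U a b \<noteq> 0 \<Longrightarrow> f a b = g a b) \<Longrightarrow> mean P U f = mean P U g"
  unfolding mean_def by (intro sum.cong refl) (metis mult_zero_left)

lemma mean_mono:
  assumes "is_dist P" "is_channel U" "\<And>a b. P a * U a b \<noteq> 0 \<Longrightarrow> f a b \<le> g a b"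
  shows "mean P U f \<le> mean P U g"
  unfolding mean_def
proof (intro sum_mono)
  fix a b
  have "0 \<le> P a * U a b" using assms by (simp add: is_dist_def channel_nonneg)
  then show "P a * U a b * f a b \<le> P a * U a b * g a b"
    using assms(3)[of a b] by (cases "P a * U a b = 0") (auto intro: mult_left_mono)
qed

lemma mean_add: "mean P U (\<lambda>a b. f a b + g a b) = mean P U f + mean P U g"
  by (simp add: mean_def distrib_left sum.distrib)

lemma mean_diff: "mean P U (\<lambda>a b. f a b - g a b) = mean P U f - mean P U g"
  by (simp add: mean_def right_diff_distrib sum_subtractf)

lemma mean_uminus: "mean P U (\<lambda>a b. - f a b) = - mean P U f"
  by (simp add: mean_def sum_negf)

lemma cond_div_eq:
  "cond_div U W P = (if abs_cont P U W then ereal (mean P U (\<lambda>a b. ln (U a b / W a b))) else \<infinity>)"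
proof (cases "abs_cont P U W")
  case True
  then show ?thesis
    by (auto simp: cond_div_def mean_def abs_cont_def simp flip: sum_ereal intro!: sum.cong)
next
  case False
  then show ?thesis
    by (auto simp: cond_div_def abs_cont_def sum_Pinfty)
qed

lemma B_val_eq:
  "B_val P U W = (if abs_cont P U W then ereal (mean P U (\<lambda>a b. - ln (W a b))) else \<infinity>)"
proof (cases "abs_cont P U W")
  case True
  then show ?thesis
    by (auto simp: B_val_def mean_def abs_cont_def simp flip: sum_ereal intro!: sum.cong)
next
  case False
  then show ?thesis
    by (auto simp: B_val_def abs_cont_def sum_Pinfty)
qed

lemma mut_inf_eq: "mut_inf P U = mean P U (\<lambda>a b. ln (U a b / out_dist P U b))"
  unfolding mut_inf_def mean_def by (intro sum.cong refl) auto

lemma out_dist_ge: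
  assumes "is_dist P" "is_channel U"
  shows "P a * U a b \<le> out_dist P U b"
  unfolding out_dist_def
  by (rule member_le_sum) (use assms in \<open>auto simp: is_dist_def channel_nonneg\<close>)

lemma out_dist_nonneg:
  assumes "is_dist P" "is_channel U"
  shows "0 \<le> out_dist P U b"
  unfolding out_dist_def using assms by (auto simp: is_dist_def channel_nonneg intro!: sum_nonneg)

lemma supp_pos:
  assumes "is_dist P" "is_channel U" "P a * U a b \<noteq> 0"
  shows "0 < P a" "0 < U a b" "0 < out_dist P U b"
proof -
  have "0 \<le> P a" "0 \<le> U a b" using assms by (auto simp: is_dist_def channel_nonneg)
  with assms(3) show "0 < P a" "0 < U a b" by auto
  then show "0 < out_dist P U b"
    using out_dist_ge[OF assms(1,2), of a b] mult_pos_pos[of "P a" "U a b"] by linarith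
qed

lemma is_dist_out_dist:
  assumes "is_dist P" "is_channel U"
  shows "is_dist (out_dist P U)"
proof -
  have "(\<Sum>b\<in>UNIV. out_dist P U b) = (\<Sum>a\<in>UNIV. P a * (\<Sum>b\<in>UNIV. U a b))"
    unfolding out_dist_def sum_distrib_left by (rule sum.swap)
  then show ?thesis
    using assms out_dist_nonneg[OF assms] by (simp add: is_dist_def channel_sum)
qed

lemma mean_out_dist: "mean P U (\<lambda>_. f) = (\<Sum>b\<in>UNIV. out_dist P U b * f b)"
  unfolding mean_def out_dist_def sum_distrib_right by (rule sum.swap)

text \<open>The left side is the output entropy H, and letter by letter the logarithms combine to H
  = I + B - D. This converts the number exp (n H) of possible outputs into the quantities of the two
  exponents.\<close>

lemma mean_ln_out_dist:
  assumes P: "is_dist P" and U: "is_channel U" and W: "is_channel W" and ac: "abs_cont P U W"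
  shows "mean P U (\<lambda>a b. - ln (out_dist P U b))
    = mut_inf P U + mean P U (\<lambda>a b. - ln (W a b)) - mean P U (\<lambda>a b. ln (U a b / W a b))"
  unfolding mut_inf_eq mean_add[symmetric] mean_diff[symmetric]
proof (rule mean_cong)
  fix a b assume "P a * U a b \<noteq> 0"
  then show "- ln (out_dist P U b) = ln (U a b / out_dist P U b) + - ln (W a b) - ln (U a b / W a b)"
    using supp_pos[OF P U, of a b] ac channel_nonneg[OF W, of a b]
    by (auto simp: ln_div abs_cont_def less_le)
qed

section \<open>Joint types as an input distribution with a channel\<close>

definition fst_marg :: "('a \<times> 'b::finite \<Rightarrow> real) \<Rightarrow> 'a \<Rightarrow> real" where
  "fst_marg t a = (\<Sum>b\<in>UNIV. t (a, b))"

text \<open>The conditional distribution is arbitrary where the first marginal vanishes; \<open>W\<close> serves as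
  a default that is a channel.\<close>
definition cond_of :: "('a \<Rightarrow> 'b::finite \<Rightarrow> real) \<Rightarrow> ('a \<times> 'b \<Rightarrow> real) \<Rightarrow> 'a \<Rightarrow> 'b \<Rightarrow> real" where
  "cond_of W t a b = (if fst_marg t a = 0 then W a b else t (a, b) / fst_marg t a)"

lemma fst_marg_nonneg: "is_dist t \<Longrightarrow> 0 \<le> fst_marg t a"
  by (simp add: fst_marg_def is_dist_def sum_nonneg)

lemma is_dist_fst_marg:
  assumes "is_dist t"
  shows "is_dist (fst_marg t)"
proof -
  have "(\<Sum>a\<in>UNIV. fst_marg t a) = 1"
    using assms by (simp add: fst_marg_def is_dist_def sum.cartesian_product)
  then show ?thesis using fst_marg_nonneg[OF assms] by (simp add: is_dist_def)
qed

lemma fst_marg_cond_of: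
  assumes "is_dist t"
  shows "fst_marg t a * cond_of W t a b = t (a, b)"
proof (cases "fst_marg t a = 0")
  case True
  then have "t (a, b) = 0"
    using assms unfolding fst_marg_def is_dist_def by (simp add: sum_nonneg_eq_0_iff)
  then show ?thesis using True by simp
qed (simp add: cond_of_def)

lemma is_channel_cond_of:
  assumes t: "is_dist t" and W: "is_channel W"
  shows "is_channel (cond_of W t)"
  unfolding is_channel_def is_dist_def
proof (intro allI conjI)
  fix a b
  show "0 \<le> cond_of W t a b"
    using t channel_nonneg[OF W] fst_marg_nonneg[OF t] by (simp add: cond_of_def is_dist_def)
  show "(\<Sum>b\<in>UNIV. cond_of W t a b) = 1"
    by (cases "fst_marg t a = 0")
       (simp_all add: cond_of_def channel_sum[OF W] fst_marg_def flip: sum_divide_distrib)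
qed

text \<open>The product over positions depends on the two words only through their joint type.
  \<open>V\<close> is kept general because it is instantiated with \<open>W\<close>, with the
  conditional distribution of \<open>t\<close> itself, and with the output distribution regarded as
  a channel that ignores its input.\<close>

lemma chan_n_joint_type:
  fixes V :: "'a::finite \<Rightarrow> 'b::finite \<Rightarrow> real"
  assumes len: "length ys = length xs" "xs \<noteq> []" and W: "is_channel W"
    and t: "t = emp (zip xs ys)" and V: "\<And>a b. t (a, b) \<noteq> 0 \<Longrightarrow> 0 < V a b"
  shows "chan_n V xs ys = exp (real (length xs) * mean (fst_marg t) (cond_of W t) (\<lambda>a b. ln (V a b)))"
proof -
  have "zip xs ys \<noteq> []" using len by (cases xs; cases ys) auto
  then have d: "is_dist t" unfolding t by (rule is_dist_emp)
  have "0 < V (xs ! i) (ys ! i)" if "i < length xs" for i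
  proof -
    have "(xs ! i, ys ! i) \<in> set (zip xs ys)" using that len by (auto simp: set_zip)
    then have "t (xs ! i, ys ! i) \<noteq> 0" using emp_pos_iff t by (metis less_irrefl)
    then show ?thesis by (rule V)
  qed
  then show ?thesis
    unfolding mean_def fst_marg_cond_of[OF d]
    by (subst chan_n_exp_sum) (simp_all add: sum_emp_zip[OF len(1), of "\<lambda>a b. ln (V a b)"] t)
qed

lemma chan_n_eq_0:
  assumes len: "length ys = length xs" and "emp (zip xs ys) (a, b) \<noteq> 0" "V a b = 0"
  shows "chan_n V xs ys = 0"
proof -
  have "0 \<le> emp (zip xs ys) (a, b)" unfolding emp_def by simp
  then have "0 < emp (zip xs ys) (a, b)" using assms(2) by linarith
  then have "(a, b) \<in> set (zip xs ys)" by (simp add: emp_pos_iff)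
  then obtain i where "i < length xs" "xs ! i = a" "ys ! i = b"
    by (auto simp: set_zip)
  then show ?thesis
    using assms(3) unfolding chan_n_def by (intro prod_zero) auto
qed

section \<open>Codes at given rates and the contribution of one joint type\<close>

locale rate_code = cloud_code +
  fixes R K :: real
  assumes R: "R > 0" and n: "n > 0"
    and M1: "exp (real n * R) / 2 \<le> real M" and M2: "real M \<le> exp (real n * R)"
    and L1: "exp (real n * K) / 2 \<le> real L" and L2: "real L \<le> exp (real n * K)"
begin

lemma ln_M: "ln (real M) \<le> real n * R"
  using M M2 by (metis exp_gt_zero ln_exp ln_mono of_nat_0_less_iff)

text \<open>The left side is the bound of \<open>expect_mx_le_log\<close> for success probability
  exp (-n B). Its first term is linear in \<open>n\<close> and its second grows exponentially only
  if B < K, so up to a polynomial factor the largest cloud count is exp (n |K - B|^+).\<close>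

lemma log_bound:
  "ln (real M) + 2 * real L * exp (- real n * B) \<le> (real n * R + 2) * exp (real n * max 0 (K - B))"
proof -
  let ?m = "exp (real n * max 0 (K - B))"
  have "real L * exp (- real n * B) \<le> exp (real n * K) * exp (- real n * B)"
    using L2 by (intro mult_right_mono) auto
  also have "\<dots> = exp (real n * (K - B))"
    by (simp add: exp_add[symmetric] algebra_simps)
  also have "\<dots> \<le> ?m" by (simp add: mult_left_mono)
  finally have 1: "real L * exp (- real n * B) \<le> ?m" .
  have "1 \<le> ?m" by simp
  moreover have "0 \<le> real n * R" using R by simp
  ultimately have "real n * R \<le> real n * R * ?m" by (simp add: mult_le_cancel_left1)
  then show ?thesis using 1 ln_M by (simp add: algebra_simps)
qed

text \<open>The factor 4 pays for rounding down both \<open>M\<close> and \<open>L\<close>.\<close>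

lemma inverse_M_L: "1 / (real M * real L) \<le> 4 * exp (- real n * (R + K))"
proof -
  have "exp (real n * R) / 2 * (exp (real n * K) / 2) \<le> real M * real L"
    using M1 L1 by (intro mult_mono) auto
  then have *: "exp (real n * (R + K)) / 4 \<le> real M * real L"
    by (simp add: exp_add distrib_left)
  have "1 / (real M * real L) \<le> 1 / (exp (real n * (R + K)) / 4)"
    using * M L by (intro divide_left_mono) auto
  also have "\<dots> = 4 * exp (- real n * (R + K))"
    unfolding mult_minus_left exp_minus by (simp add: field_simps)
  finally show ?thesis .
qed

text \<open>Two bounds hold for the class of a joint type PU: the sum of the means gives exponent D,
  and the logarithmic bound times the number of possible outputs gives D + R - I - |B - K|^+. The
  objective of \<open>E_c\<close> at this pair is the larger of the two, so \<open>e\<close> is at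
  most one of them.\<close>

lemma type_class_bound:
  fixes e :: real
  defines "A \<equiv> \<lambda>t y. {m. m < M \<and> emp (zip (c m) y) = t}"
  assumes e: "ereal e \<le> E_c W R K"
  shows "(\<Sum>y\<in>seqs. expect (mx (A t y) y)) / (real M * real L) \<le> 4 * (real n * R + 2) * exp (- real n * e)"
proof -
  let ?P = "fst_marg t" and ?U = "cond_of W t"
  let ?Q = "out_dist ?P ?U"
  let ?S = "\<Sum>y\<in>seqs. expect (mx (A t y) y)"
  have rhs: "0 \<le> 4 * (real n * R + 2) * exp (- real n * e)"
    using R by simp
  have AM: "A t y \<subseteq> {..<M}" for y by (auto simp: A_def)
  have empty: "mx {} y = (\<lambda>_. 0)" for y by (rule ext) (simp add: mx_def)
  have MLpos: "0 < real M * real L" using M L by simp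
  show ?thesis
  proof (cases "\<exists>y\<in>seqs. A t y \<noteq> {}")
    case False
    then have "?S = 0" by (simp add: empty expect_const)
    then show ?thesis using rhs by simp
  next
    case True
    then obtain y0 m0 where y0: "y0 \<in> seqs" "m0 < M" "t = emp (zip (c m0) y0)"
      by (auto simp: A_def)
    have len0: "length y0 = n" "length (c m0) = n" using y0 len by (auto simp: seqs_def)
    have "zip (c m0) y0 \<noteq> []" using len0 n by (cases "c m0"; cases y0) auto
    then have t: "is_dist t" unfolding y0 by (rule is_dist_emp)
    note P = is_dist_fst_marg[OF t] and U = is_channel_cond_of[OF t W]
    note PU = fst_marg_cond_of[OF t]
    have mY: "length y = n \<and> length (c m) = n \<and> c m \<noteq> [] \<and> t = emp (zip (c m) y)"
      if "y \<in> seqs" "m \<in> A t y" for y m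
      using that len[of m] n by (auto simp: A_def seqs_def)
    show ?thesis
    proof (cases "abs_cont ?P ?U W")
      \<comment> \<open>A joint type that uses a transition of \<open>W\<close>-probability zero
        almost surely never occurs, so all its expected counts vanish.\<close>
      case False
      then obtain a b where ab: "t (a, b) \<noteq> 0" "W a b = 0"
        by (auto simp: abs_cont_def PU)
      have "expect (mx (A t y) y) \<le> 0" if y: "y \<in> seqs" for y
      proof -
        have "chan_n W (c m) y = 0" if "m \<in> A t y" for m
          using mY[OF y that] ab by (intro chan_n_eq_0[of _ _ a b]) auto
        then show ?thesis using expect_mx_le_sum[OF AM[of y] y] by simp
      qed
      then have "?S \<le> 0" by (rule sum_nonpos)
      then show ?thesis using rhs MLpos by (meson divide_nonpos_pos order_trans)
    next
      case ac: True
      define D where "D = mean ?P ?U (\<lambda>a b. ln (?U a b / W a b))"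
      define B where "B = mean ?P ?U (\<lambda>a b. - ln (W a b))"
      define H where "H = mean ?P ?U (\<lambda>a b. - ln (?Q b))"
      define I where "I = mut_inf ?P ?U"
      have H: "H = I + B - D"
        unfolding H_def I_def B_def D_def by (rule mean_ln_out_dist[OF P U W ac])
      have Wpos: "0 < W a b" if "t (a, b) \<noteq> 0" for a b
        using that ac channel_nonneg[OF W, of a b] by (auto simp: abs_cont_def PU less_le)
      have Upos: "0 < ?U a b" and Qpos: "0 < ?Q b" if "t (a, b) \<noteq> 0" for a b
        using supp_pos[OF P U, of a b] that by (auto simp: PU)
      have chW: "chan_n W (c m) y = exp (- real n * B)" if "y \<in> seqs" "m \<in> A t y" for y m
        using chan_n_joint_type[where V = W and W = W and xs = "c m" and ys = y and t = t] mY[OF that] Wpos W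
        by (simp add: B_def mean_uminus)
      have chQ: "chan_n (\<lambda>_. ?Q) (c m) y = exp (- real n * H)" if "y \<in> seqs" "m \<in> A t y" for y m
        using chan_n_joint_type[where V = "\<lambda>_. ?Q" and W = W and xs = "c m" and ys = y and t = t] mY[OF that] Qpos W
        by (simp add: H_def mean_uminus)
      have D: "D = mean ?P ?U (\<lambda>a b. ln (?U a b)) + B"
        unfolding D_def B_def mean_add[symmetric]
      proof (rule mean_cong)
        fix a b assume "?P a * ?U a b \<noteq> 0"
        then have "t (a, b) \<noteq> 0" by (simp add: PU)
        from Upos[OF this] Wpos[OF this] show "ln (?U a b / W a b) = ln (?U a b) + - ln (W a b)"
          by (simp add: ln_div)
      qed
      have chU: "chan_n W (c m) y = exp (- real n * D) * chan_n ?U (c m) y"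
        if "y \<in> seqs" "m \<in> A t y" for y m
        using chan_n_joint_type[where V = ?U and W = W and xs = "c m" and ys = y and t = t] mY[OF that] Upos W
        by (simp add: chW[OF that] D exp_add[symmetric] algebra_simps)

      \<comment> \<open>First bound, by change of measure: on this class the
        \<open>W\<close>-probability is the \<open>?U\<close>-probability times the constant exp (-n
        D), and the \<open>?U\<close>-probabilities of each codeword sum to 1 over all
        outputs.\<close>
      have "?S \<le> (\<Sum>y\<in>seqs. real L * (\<Sum>m\<in>A t y. chan_n W (c m) y))"
        by (intro sum_mono expect_mx_le_sum AM)
      also have "\<dots> = (\<Sum>y\<in>seqs. real L * (\<Sum>m\<in>A t y. exp (- real n * D) * chan_n ?U (c m) y))"
        by (intro sum.cong refl arg_cong2[of _ _ _ _ "(*)"]) (rule chU)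
      also have "\<dots> \<le> (\<Sum>y\<in>seqs. real L * (\<Sum>m<M. exp (- real n * D) * chan_n ?U (c m) y))"
        by (intro sum_mono mult_left_mono sum_mono2 AM) (auto simp: chan_n_nonneg[OF U])
      also have "\<dots> = real L * exp (- real n * D) * (\<Sum>m<M. \<Sum>y\<in>seqs. chan_n ?U (c m) y)"
        by (simp add: sum_distrib_left[symmetric] sum.swap[of _ seqs])
      also have "\<dots> = real L * exp (- real n * D) * real M"
      proof -
        have "(\<Sum>y\<in>seqs. chan_n ?U (c m) y) = 1" if "m < M" for m
          using sum_chan_n[OF U, of "c m"] len[OF that] by (simp add: seqs_def)
        then show ?thesis by simp
      qed
      finally have 1: "?S / (real M * real L) \<le> exp (- real n * D)"
        using MLpos by (simp add: field_simps)

      \<comment> \<open>Second bound. Every output that can form this joint type has probability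
        exactly exp (-n H) under the product law \<open>?Q\<close>, so there are at most exp (n H)
        of them. This law ignores the codeword, so \<open>c m0\<close> serves only to fix the
        length.\<close>
      define Y where "Y = {y \<in> seqs. A t y \<noteq> {}}"
      have Ysub: "Y \<subseteq> {ys. length ys = length (c m0)}" using len0 by (auto simp: Y_def seqs_def)
      have Q: "is_channel (\<lambda>_::'a. ?Q)"
        using is_dist_out_dist[OF P U] by (simp add: is_channel_def)
      have "real (card Y) * exp (- real n * H) = (\<Sum>y\<in>Y. exp (- real n * H))" by simp
      also have "\<dots> = (\<Sum>y\<in>Y. chan_n (\<lambda>_. ?Q) (c m0) y)"
      proof (rule sum.cong[OF refl])
        fix y assume "y \<in> Y"
        then obtain m where m: "y \<in> seqs" "m \<in> A t y" by (auto simp: Y_def)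
        then have "chan_n (\<lambda>_. ?Q) (c m0) y = chan_n (\<lambda>_. ?Q) (c m) y"
          using mY[OF m] len0 by (simp add: chan_n_def)
        then show "exp (- real n * H) = chan_n (\<lambda>_. ?Q) (c m0) y" using chQ[OF m] by simp
      qed
      also have "\<dots> \<le> 1" by (rule sum_chan_n_le_1[OF Q Ysub])
      finally have cardY: "real (card Y) \<le> exp (real n * H)"
        by (simp add: exp_minus field_simps)
      have "?S = (\<Sum>y\<in>Y. expect (mx (A t y) y))"
        by (rule sum.mono_neutral_right) (auto simp: Y_def empty expect_const)
      also have "\<dots> \<le> (\<Sum>y\<in>Y. (real n * R + 2) * exp (real n * max 0 (K - B)))"
      proof (rule sum_mono)
        fix y assume "y \<in> Y"
        then have y: "y \<in> seqs" by (simp add: Y_def)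
        have "expect (mx (A t y) y) \<le> ln (real M) + 2 * real L * exp (- real n * B)"
          by (rule expect_mx_le_log[OF AM y]) (use chW[OF y] in auto)
        also note log_bound
        finally show "expect (mx (A t y) y) \<le> (real n * R + 2) * exp (real n * max 0 (K - B))" .
      qed
      also have "\<dots> \<le> exp (real n * H) * ((real n * R + 2) * exp (real n * max 0 (K - B)))"
        using cardY R by (auto intro!: mult_right_mono)
      finally have "?S / (real M * real L)
          \<le> exp (real n * H) * ((real n * R + 2) * exp (real n * max 0 (K - B))) * (1 / (real M * real L))"
        using MLpos by (simp add: divide_right_mono)
      also have "\<dots> \<le> exp (real n * H) * ((real n * R + 2) * exp (real n * max 0 (K - B)))
          * (4 * exp (- real n * (R + K)))"
        using R by (intro mult_left_mono inverse_M_L) auto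
      also have "\<dots> = 4 * (real n * R + 2)
          * (exp (real n * H) * exp (real n * max 0 (K - B)) * exp (- real n * (R + K)))"
        by simp
      \<comment> \<open>Combines H = I + B - D with max 0 (K - B) - (K - B) = max 0 (B - K).\<close>
      also have "exp (real n * H) * exp (real n * max 0 (K - B)) * exp (- real n * (R + K))
          = exp (- real n * (D + (R - I - max 0 (B - K))))"
        unfolding exp_add[symmetric] H by (simp add: algebra_simps max_def)
      finally have 2: "?S / (real M * real L)
        \<le> 4 * (real n * R + 2) * exp (- real n * (D + (R - I - max 0 (B - K))))" .

      have "ereal e \<le> cond_div ?U W ?P + posp (ereal R - ereal (mut_inf ?P ?U)
          - posp (B_val ?P ?U W - ereal K))"
        using e P U unfolding E_c_def le_INF_iff by force
      also have "\<dots> = ereal (D + max 0 (R - I - max 0 (B - K)))"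
        using ac by (simp add: cond_div_eq B_val_eq posp_def D_def I_def B_def
            ereal_max_0 flip: ereal_max zero_ereal_def)
      finally have "e \<le> D + max 0 (R - I - max 0 (B - K))" by simp
      then consider "e \<le> D" | "e \<le> D + (R - I - max 0 (B - K))" by fastforce
      then show ?thesis
      proof cases
        case 1
        have "exp (- real n * D) \<le> 1 * exp (- real n * e)"
          using 1 by (simp add: mult_left_mono)
        also have "\<dots> \<le> 4 * (real n * R + 2) * exp (- real n * e)"
          using R by (intro mult_right_mono) auto
        finally show ?thesis using \<open>?S / (real M * real L) \<le> exp (- real n * D)\<close> by linarith
      next
        case 2
        have "exp (- real n * (D + (R - I - max 0 (B - K)))) \<le> exp (- real n * e)"
          using 2 by (simp add: mult_left_mono)
        then have "4 * (real n * R + 2) * exp (- real n * (D + (R - I - max 0 (B - K))))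
            \<le> 4 * (real n * R + 2) * exp (- real n * e)"
          using R by (intro mult_left_mono) auto
        with \<open>?S / (real M * real L) \<le> 4 * (real n * R + 2) * _\<close> show ?thesis by linarith
      qed
    qed
  qed
qed

text \<open>The winning codeword has some joint type with the output, so the maximum over all
  messages is at most the sum over joint types of the maxima within each class. The number of types
  costs only a polynomial factor.\<close>

lemma correct_le:
  assumes e: "ereal e \<le> E_c W R K"
  shows "correct \<le> 4 * (real n * R + 2) * (real n + 1) ^ card (UNIV :: ('a \<times> 'b) set) * exp (- real n * e)"
proof -
  define A where "A = (\<lambda>t (y :: 'b list). {m. m < M \<and> emp (zip (c m) y) = t})"
  have "mx {..<M} y Y \<le> (\<Sum>t\<in>types n. mx (A t y) y Y)" if y: "y \<in> seqs" for y Y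
  proof -
    obtain m where m: "m \<in> {..<M}" "mx {..<M} y Y = real (copies L Y m y)"
      by (rule mx_attained[of "{..<M}"]) (use M in auto)
    let ?t = "emp (zip (c m) y)"
    have "mx {..<M} y Y \<le> mx (A ?t y) y Y"
      unfolding m(2) using m(1) by (intro mx_ge) (auto simp: A_def)
    also have "\<dots> \<le> (\<Sum>t\<in>types n. mx (A t y) y Y)"
      using y m(1) len by (intro member_le_sum[where f = "\<lambda>t. mx (A t y) y Y"])
        (auto simp: types_def seqs_def mx_nonneg)
    finally show ?thesis .
  qed
  then have "expect (mx {..<M} y) \<le> expect (\<lambda>Y. \<Sum>t\<in>types n. mx (A t y) y Y)" if "y \<in> seqs" for y
    using that by (intro expect_mono)
  then have "(\<Sum>y\<in>seqs. expect (mx {..<M} y)) \<le> (\<Sum>y\<in>seqs. \<Sum>t\<in>types n. expect (mx (A t y) y))"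
    unfolding expect_sum by (rule sum_mono)
  also have "\<dots> = (\<Sum>t\<in>types n. \<Sum>y\<in>seqs. expect (mx (A t y) y))"
    by (rule sum.swap)
  finally have "correct \<le> (\<Sum>t\<in>types n. (\<Sum>y\<in>seqs. expect (mx (A t y) y)) / (real M * real L))"
    unfolding correct_def sum_divide_distrib[symmetric] by (rule divide_right_mono) simp
  also have "\<dots> \<le> (\<Sum>t\<in>(types n :: ('a \<times> 'b \<Rightarrow> real) set). 4 * (real n * R + 2) * exp (- real n * e))"
    using type_class_bound[OF e] by (intro sum_mono) (simp add: A_def)
  also have "\<dots> \<le> (real n + 1) ^ card (UNIV :: ('a \<times> 'b) set) * (4 * (real n * R + 2) * exp (- real n * e))"
  proof -
    have "real (card (types n :: ('a \<times> 'b \<Rightarrow> real) set)) \<le> real ((n + 1) ^ card (UNIV :: ('a \<times> 'b) set))"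
      using card_types by (simp only: of_nat_le_iff)
    then show ?thesis using R by (auto intro!: mult_right_mono simp: add.commute)
  qed
  finally show ?thesis by (simp add: algebra_simps)
qed

end

lemma rate_code_codebooks:
  assumes "is_channel W" "R > 0" "K > 0" "c \<in> codebooks n (num_msgs n R)" "n > 0"
  shows "rate_code W n (num_msgs n R) (num_msgs n K) c R K"
  using cloud_code_codebooks[OF assms(1-4)] num_msgs_bounds[of R n] num_msgs_bounds[of K n] assms
  by (simp add: rate_code_def rate_code_axioms_def)

section \<open>Polynomial factors against exponentials\<close>

lemma ln_over_n: "(\<lambda>n. (a + real k * ln (real n + 1)) / real n) \<longlonglongrightarrow> 0"
proof -
  have "filterlim (\<lambda>n. real n + 1) at_top sequentially"
    by (rule filterlim_at_top_mono[OF filterlim_real_sequentially]) simp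
  from filterlim_compose[OF ln_x_over_x_tendsto_0 this]
  have "(\<lambda>n. ln (real n + 1) / (real n + 1)) \<longlonglongrightarrow> 0" .
  moreover have "(\<lambda>n. (real n + 1) / real n) \<longlonglongrightarrow> 1"
    using LIMSEQ_Suc_n_over_n by (simp add: add.commute)
  ultimately have "(\<lambda>n. ln (real n + 1) / (real n + 1) * ((real n + 1) / real n)) \<longlonglongrightarrow> 0 * 1"
    by (rule tendsto_mult)
  then have "(\<lambda>n. ln (real n + 1) / real n) \<longlonglongrightarrow> 0" by simp
  then have "(\<lambda>n. a * (1 / real n) + real k * (ln (real n + 1) / real n)) \<longlonglongrightarrow> a * 0 + real k * 0"
    by (intro tendsto_intros lim_1_over_n)
  then show ?thesis by (simp add: add_divide_distrib)
qed

lemma eventually_poly_less_exp: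
  assumes "d > 0"
  shows "\<forall>\<^sub>F n in sequentially. C * (real n + 1) ^ k < exp (real n * d)"
proof (cases "C > 0")
  case True
  have "\<forall>\<^sub>F n in sequentially. (ln C + real k * ln (real n + 1)) / real n < d"
    by (rule order_tendstoD(2)[OF ln_over_n assms])
  then show ?thesis
    using eventually_gt_at_top[of 0]
  proof eventually_elim
    case (elim n)
    then have "ln C + real k * ln (real n + 1) < real n * d"
      by (simp add: divide_less_eq mult.commute)
    moreover have "ln C + real k * ln (real n + 1) = ln (C * (real n + 1) ^ k)"
      using True by (simp add: ln_mult ln_realpow)
    ultimately have "exp (ln (C * (real n + 1) ^ k)) < exp (real n * d)"
      by (simp only: exp_less_cancel_iff)
    then show ?case using True by simp
  qed
next
  case False
  have "C * (real n + 1) ^ k < exp (real n * d)" for n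
  proof -
    have "C * (real n + 1) ^ k \<le> 0" using False by (intro mult_nonpos_nonneg) auto
    also have "0 < exp (real n * d)" by simp
    finally show ?thesis .
  qed
  then show ?thesis by simp
qed

lemma liminf_correct:
  fixes W :: "'x::finite \<Rightarrow> 'y::finite \<Rightarrow> real"
  assumes W: "is_channel W" and R: "R > 0" and K: "K > 0"
  shows "E_c W R K \<le> liminf (\<lambda>n. INF c \<in> codebooks n (num_msgs n R).
            neglog_rate n (1 - err_prob W n R K c))"
  unfolding le_Liminf_iff
proof (intro allI impI)
  fix x assume "x < E_c W R K"
  \<comment> \<open>Two real numbers are placed between \<open>x\<close> and \<open>E_c\<close>: the
    gap from \<open>z\<close> to \<open>e\<close> absorbs the polynomial factor, and the gap from
    \<open>x\<close> to \<open>z\<close> keeps the inequality strict after the infimum over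
    codebooks. This also covers an infinite \<open>E_c\<close>.\<close>
  then obtain z where z: "x < ereal z" "ereal z < E_c W R K"
    using ereal_dense2 by blast
  then obtain e where e: "ereal z < ereal e" "ereal e < E_c W R K"
    using ereal_dense2 by blast
  let ?k = "card (UNIV :: ('x \<times> 'y) set)"
  have "e - z > 0" using e by simp
  from eventually_poly_less_exp[OF this, of "4 * (R + 2)" "?k + 1"]
  show "\<forall>\<^sub>F n in sequentially. x < (INF c \<in> codebooks n (num_msgs n R).
            neglog_rate n (1 - err_prob W n R K c))"
    using eventually_gt_at_top[of 0]
  proof eventually_elim
    case (elim n)
    have "ereal z \<le> neglog_rate n (1 - err_prob W n R K c)"
      if c: "c \<in> codebooks n (num_msgs n R)" for c
    proof -
      interpret rate_code W n "num_msgs n R" "num_msgs n K" c R K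
        by (rule rate_code_codebooks) (use W R K c elim in auto)
      have err: "1 - err_prob W n R K c = correct"
        using err_prob_eq[OF cloud_code_axioms] by simp
      have "correct \<le> 4 * (real n * R + 2) * (real n + 1) ^ ?k * exp (- real n * e)"
        using e by (intro correct_le) auto
      also have "\<dots> \<le> 4 * ((R + 2) * (real n + 1)) * (real n + 1) ^ ?k * exp (- real n * e)"
        using R by (intro mult_right_mono mult_left_mono) (auto simp: algebra_simps)
      also have "\<dots> = (4 * (R + 2) * (real n + 1) ^ (?k + 1)) * exp (- real n * e)"
        by simp
      also have "\<dots> \<le> exp (real n * (e - z)) * exp (- real n * e)"
        using elim by (intro mult_right_mono) auto
      also have "\<dots> = exp (- real n * z)"
        by (simp add: exp_add[symmetric] algebra_simps)
      finally have le: "correct \<le> exp (- real n * z)" .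
      have "0 \<le> correct"
        unfolding correct_def expect_def
        by (intro divide_nonneg_nonneg sum_nonneg mult_nonneg_nonneg inst_prob_nonneg mx_nonneg) auto
      then consider "correct = 0" | "correct > 0" by linarith
      then show ?thesis
      proof cases
        case 2
        then have "ln correct \<le> - real n * z"
          using le by (metis exp_gt_zero ln_exp ln_le_cancel_iff)
        then have "z \<le> - ln correct / real n"
          using elim by (subst pos_le_divide_eq) (auto simp: mult.commute)
        then show ?thesis unfolding err neglog_rate_def by simp
      qed (simp add: err neglog_rate_def)
    qed
    then have "ereal z \<le> (INF c \<in> codebooks n (num_msgs n R). neglog_rate n (1 - err_prob W n R K c))"
      by (rule INF_greatest)
    then show ?case using z by simp
  qed
qed

section \<open>The error exponent\<close>

lemma mult_ln_squared_le:
  fixes u :: real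
  assumes "0 \<le> u" "u \<le> 1"
  shows "u * (ln u)\<^sup>2 \<le> 4"
proof (cases "u = 0")
  case False
  \<comment> \<open>The substitution u = s^2 turns the claim into (s ln s)^2 <= 1, which follows
    from ln (1/s) <= 1/s - 1.\<close>
  define s where "s = sqrt u"
  have s: "0 < s" "s \<le> 1" "u = s\<^sup>2" using assms False by (auto simp: s_def)
  have "ln (1 / s) \<le> 1 / s - 1" using s by (intro ln_le_minus_one) auto
  then have "s * (- ln s) \<le> s * (1 / s - 1)"
    using s by (intro mult_left_mono) (auto simp: ln_div)
  then have "s * (- ln s) \<le> 1" using s by (simp add: algebra_simps)
  moreover have "0 \<le> s * (- ln s)" using s by (simp add: mult_le_0_iff)
  ultimately have "(s * (- ln s))\<^sup>2 \<le> 1" by (simp add: abs_square_le_1 abs_le_iff)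
  moreover have "u * (ln u)\<^sup>2 = 4 * (s * (- ln s))\<^sup>2"
    using s by (simp add: ln_realpow power_mult_distrib)
  ultimately show ?thesis by simp
qed simp

lemma is_dist_le_1:
  assumes "is_dist P"
  shows "P a \<le> 1"
proof -
  have "P a \<le> sum P UNIV"
    using assms by (intro member_le_sum) (auto simp: is_dist_def)
  then show ?thesis using assms by (simp add: is_dist_def)
qed

text \<open>Depends only on \<open>W\<close> and the alphabets, so the block length from which
  Chebyshev's inequality is effective is the same for all \<open>P\<close>, \<open>U\<close> and
  codebooks. The shape comes from (a - b)^2 <= 2 a^2 + 2 b^2 for ln U - ln W, where u (ln u)^2 <= 4
  contributes 4 per output letter.\<close>

definition var_bound :: "('a::finite \<Rightarrow> 'b::finite \<Rightarrow> real) \<Rightarrow> real" where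
  "var_bound W = 8 * real (card (UNIV :: 'b set)) + 2 * (\<Sum>a\<in>UNIV. \<Sum>b\<in>UNIV. (ln (W a b))\<^sup>2)"

lemma var_bounds:
  fixes P :: "'a::finite \<Rightarrow> real" and U W :: "'a \<Rightarrow> 'b::finite \<Rightarrow> real"
  assumes P: "is_dist P" and U: "is_channel U" and W: "is_channel W" and ac: "abs_cont P U W"
  shows "mean P U (\<lambda>a b. (ln (out_dist P U b))\<^sup>2) \<le> var_bound W"
    and "mean P U (\<lambda>a b. (ln (W a b))\<^sup>2) \<le> var_bound W"
    and "mean P U (\<lambda>a b. (ln (U a b / W a b))\<^sup>2) \<le> var_bound W"
proof -
  let ?N = "real (card (UNIV :: 'b set))"
  define cW where "cW = (\<Sum>a\<in>UNIV. \<Sum>b\<in>UNIV. (ln (W a b))\<^sup>2)"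
  have cW: "0 \<le> cW" by (simp add: cW_def sum_nonneg)
  have V: "var_bound W = 8 * ?N + 2 * cW" by (simp add: var_bound_def cW_def)
  have "(\<Sum>b\<in>UNIV. out_dist P U b * (ln (out_dist P U b))\<^sup>2) \<le> (\<Sum>b\<in>(UNIV :: 'b set). 4)"
    using is_dist_out_dist[OF P U] is_dist_le_1[OF is_dist_out_dist[OF P U]]
    by (intro sum_mono mult_ln_squared_le) (auto simp: is_dist_def)
  then show "mean P U (\<lambda>a b. (ln (out_dist P U b))\<^sup>2) \<le> var_bound W"
    using cW by (simp add: mean_out_dist V)
  have lnU: "mean P U (\<lambda>a b. (ln (U a b))\<^sup>2) \<le> 4 * ?N"
  proof -
    have "mean P U (\<lambda>a b. (ln (U a b))\<^sup>2) = (\<Sum>a\<in>UNIV. P a * (\<Sum>b\<in>UNIV. U a b * (ln (U a b))\<^sup>2))"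
      by (simp add: mean_def sum_distrib_left mult.assoc)
    also have "\<dots> \<le> (\<Sum>a\<in>UNIV. P a * (\<Sum>b\<in>(UNIV :: 'b set). 4))"
      using P channel_nonneg[OF U] channel_le_1[OF U]
      by (intro sum_mono mult_left_mono mult_ln_squared_le) (auto simp: is_dist_def)
    also have "\<dots> = 4 * ?N" using P by (simp add: is_dist_def flip: sum_distrib_right)
    finally show ?thesis .
  qed
  have lnW: "mean P U (\<lambda>a b. (ln (W a b))\<^sup>2) \<le> cW"
  proof -
    have "(ln (W a b))\<^sup>2 \<le> cW" for a b
    proof -
      have "(ln (W a b))\<^sup>2 \<le> (\<Sum>b\<in>UNIV. (ln (W a b))\<^sup>2)"
        by (rule member_le_sum) auto
      also have "\<dots> \<le> cW"
        unfolding cW_def by (rule member_le_sum) (auto intro: sum_nonneg)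
      finally show ?thesis .
    qed
    then have "mean P U (\<lambda>a b. (ln (W a b))\<^sup>2) \<le> mean P U (\<lambda>a b. cW)"
      by (intro mean_mono[OF P U])
    also have "\<dots> = cW"
      using is_dist_out_dist[OF P U] unfolding mean_out_dist[of P U "\<lambda>_. cW"] sum_distrib_right[symmetric]
      by (simp add: is_dist_def)
    finally show ?thesis .
  qed
  then show "mean P U (\<lambda>a b. (ln (W a b))\<^sup>2) \<le> var_bound W"
    using cW V by simp
  have "mean P U (\<lambda>a b. (ln (U a b / W a b))\<^sup>2)
      \<le> mean P U (\<lambda>a b. ((ln (U a b))\<^sup>2 + (ln (U a b))\<^sup>2) + ((ln (W a b))\<^sup>2 + (ln (W a b))\<^sup>2))"
  proof (rule mean_mono[OF P U])
    fix a b assume ab: "P a * U a b \<noteq> 0"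
    have "0 < W a b" using ab ac channel_nonneg[OF W, of a b] by (auto simp: abs_cont_def less_le)
    then have "ln (U a b / W a b) = ln (U a b) - ln (W a b)"
      using supp_pos[OF P U ab] by (simp add: ln_div)
    moreover have "0 \<le> (ln (U a b) + ln (W a b))\<^sup>2" by simp
    ultimately show "(ln (U a b / W a b))\<^sup>2
        \<le> ((ln (U a b))\<^sup>2 + (ln (U a b))\<^sup>2) + ((ln (W a b))\<^sup>2 + (ln (W a b))\<^sup>2)"
      by (simp only: power2_sum power2_diff)
  qed
  then show "mean P U (\<lambda>a b. (ln (U a b / W a b))\<^sup>2) \<le> var_bound W"
    using lnU lnW V unfolding mean_add by linarith
qed

lemma sum_codeword_mean:
  fixes U g :: "'a::finite \<Rightarrow> 'b::finite \<Rightarrow> real"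
  shows "(\<Sum>i<length xs. \<Sum>b\<in>UNIV. U (xs ! i) b * g (xs ! i) b) = real (length xs) * mean (emp xs) U g"
  using sum_emp[of "\<lambda>a. \<Sum>b\<in>UNIV. U a b * g a b" xs]
  by (simp add: mean_def sum_distrib_left mult.assoc)

lemma feasible_iff:
  "ereal (mut_inf P U) + posp (B_val P U W - ereal K) \<le> ereal R \<longleftrightarrow>
    abs_cont P U W \<and> mut_inf P U + max 0 (mean P U (\<lambda>a b. - ln (W a b)) - K) \<le> R"
  by (auto simp: B_val_eq posp_def zero_ereal_def simp flip: ereal_max)

section \<open>Losing copies among the typical outputs of one input type\<close>

context rate_code
begin

text \<open>The bound 1/6 is chosen so that three exceptional sets together leave probability at
  least 1/2.\<close>

lemma chebyshev_codeword:
  assumes U: "is_channel U" and m: "m < M" and V: "mean (emp (c m)) U (\<lambda>a b. (g a b)\<^sup>2) \<le> V"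
    and \<epsilon>: "\<epsilon> > 0" "6 * V \<le> real n * \<epsilon>\<^sup>2"
  shows "(\<Sum>ys\<in>{ys\<in>seqs. real n * \<epsilon> \<le> \<bar>(\<Sum>i<n. g (c m ! i) (ys ! i)) - real n * mean (emp (c m)) U g\<bar>}.
       chan_n U (c m) ys) \<le> 1 / 6"
proof -
  have "(\<Sum>ys\<in>{ys\<in>seqs. real n * \<epsilon> \<le> \<bar>(\<Sum>i<n. g (c m ! i) (ys ! i)) - real n * mean (emp (c m)) U g\<bar>}.
       chan_n U (c m) ys) \<le> real n * mean (emp (c m)) U (\<lambda>a b. (g a b)\<^sup>2) / (real n * \<epsilon>)\<^sup>2"
    using chan_n_chebyshev[OF U, of "real n * \<epsilon>" "c m" g, unfolded sum_codeword_mean]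
      sum_codeword_mean[where xs = "c m" and U = U and g = "\<lambda>a b. (g a b)\<^sup>2"] n \<epsilon>(1) len[OF m]
    by (simp add: seqs_def)
  also have "\<dots> \<le> real n * V / (real n * \<epsilon>)\<^sup>2"
    using V by (intro divide_right_mono mult_left_mono) auto
  also have "\<dots> \<le> 1 / 6"
    using n \<epsilon> by (simp add: power2_eq_square field_simps)
  finally show ?thesis .
qed

text \<open>Weak typicality for a single statistic: only the sum of \<open>g\<close> along the words
  is controlled, not the letter frequencies.\<close>

definition typical :: "('a \<Rightarrow> real) \<Rightarrow> ('a \<Rightarrow> 'b \<Rightarrow> real) \<Rightarrow> real \<Rightarrow> ('a \<Rightarrow> 'b \<Rightarrow> real) \<Rightarrow> nat \<Rightarrow> 'b list set" where
  "typical P U \<epsilon> g m = {ys\<in>seqs. \<bar>(\<Sum>i<n. g (c m ! i) (ys ! i)) - real n * mean P U g\<bar> < real n * \<epsilon>}"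

text \<open>On typical outputs the codewords in \<open>A\<close> produce at least
  \<open>card A * L\<close> * exp (-n (D + \<epsilon>)) / 2 expected copies. At most one cloud wins
  for each output, and the winning copies are bounded by the logarithmic bound times the number of
  typical outputs. The rate margin 5 \<epsilon> makes this subtracted term exponentially
  smaller.\<close>

lemma one_minus_correct_ge:
  fixes P :: "'a \<Rightarrow> real" and U :: "'a \<Rightarrow> 'b \<Rightarrow> real"
  assumes P: "is_dist P" and U: "is_channel U" and ac: "abs_cont P U W"
    and \<epsilon>: "\<epsilon> > 0" "6 * var_bound W \<le> real n * \<epsilon>\<^sup>2"
    and feas: "mut_inf P U + max 0 (mean P U (\<lambda>a b. - ln (W a b)) - K) \<le> R - 5 * \<epsilon>"
    and A: "A = {m. m < M \<and> emp (c m) = P}" "A \<noteq> {}"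
    and D: "D = mean P U (\<lambda>a b. ln (U a b / W a b))"
  shows "real (card A) / real M * exp (- real n * (D + \<epsilon>)) / 2
      - 4 * (real n * R + 2) * exp (- real n * (D + 3 * \<epsilon>)) \<le> 1 - correct"
proof -
  let ?Q = "out_dist P U"
  define B where "B = mean P U (\<lambda>a b. - ln (W a b))"
  define H where "H = mean P U (\<lambda>a b. - ln (?Q b))"
  define I where "I = mut_inf P U"
  have H: "H = I + B - D"
    unfolding H_def I_def B_def D by (rule mean_ln_out_dist[OF P U W ac])
  let ?g1 = "\<lambda>a b. ln (U a b / W a b)" and ?g2 = "\<lambda>a b. ln (W a b)" and ?g3 = "\<lambda>a::'a. \<lambda>b. ln (?Q b)"
  \<comment> \<open>The three statistics have separate purposes: \<open>?g1\<close> bounds the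
    \<open>W\<close>-probability from below by the \<open>U\<close>-probability, \<open>?g2\<close>
    bounds it from above, and \<open>?g3\<close> bounds the number of outputs. Excluding words of
    \<open>U\<close>-probability zero ensures that all logarithms have positive arguments.\<close>
  define G where "G = (\<lambda>m. {ys \<in> typical P U \<epsilon> ?g1 m \<inter> typical P U \<epsilon> ?g2 m \<inter> typical P U \<epsilon> ?g3 m.
      chan_n U (c m) ys \<noteq> 0})"
  have AM: "A \<subseteq> {..<M}" and finA: "finite A" using A by auto
  have mA: "m < M" "length (c m) = n" "emp (c m) = P" if "m \<in> A" for m
    using that A len by auto
  have Gseqs: "G m \<subseteq> seqs" for m by (auto simp: G_def typical_def)
  have supp: "0 < U (c m ! i) (ys ! i)" "0 < W (c m ! i) (ys ! i)" "0 < ?Q (ys ! i)"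
    if "m \<in> A" "ys \<in> G m" "i < n" for m ys i
  proof -
    have "U (c m ! i) (ys ! i) \<noteq> 0"
      using that mA by (auto simp: G_def chan_n_def)
    moreover have "0 < P (c m ! i)"
      using emp_pos_iff[of "c m"] mA[OF \<open>m \<in> A\<close>] that(3) by auto
    ultimately have *: "P (c m ! i) * U (c m ! i) (ys ! i) \<noteq> 0" by simp
    show "0 < U (c m ! i) (ys ! i)" "0 < ?Q (ys ! i)" using supp_pos[OF P U *] by auto
    show "0 < W (c m ! i) (ys ! i)"
      using * ac channel_nonneg[OF W, of "c m ! i" "ys ! i"] by (auto simp: abs_cont_def less_le)
  qed
  have typ_le: "\<bar>(\<Sum>i<n. g (c m ! i) (ys ! i)) - real n * mean P U g\<bar> < real n * \<epsilon>"
    if "ys \<in> G m" "g = ?g1 \<or> g = ?g2 \<or> g = ?g3" for m ys g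
    using that by (auto simp: G_def typical_def)
  have chW: "chan_n W (c m) ys \<le> exp (- real n * (B - \<epsilon>))" if m: "m \<in> A" "ys \<in> G m" for m ys
  proof -
    have "chan_n W (c m) ys = exp (\<Sum>i<n. ln (W (c m ! i) (ys ! i)))"
      using chan_n_exp_sum[of "c m" W ys] supp[OF m] mA(2)[OF m(1)] by simp
    also have "\<dots> \<le> exp (- real n * (B - \<epsilon>))"
      using typ_le[OF m(2), of ?g2] by (simp add: B_def mean_uminus algebra_simps)
    finally show ?thesis .
  qed
  have chU: "chan_n U (c m) ys * exp (- real n * (D + \<epsilon>)) \<le> chan_n W (c m) ys"
    if m: "m \<in> A" "ys \<in> G m" for m ys
  proof -
    have 1: "chan_n W (c m) ys = exp (\<Sum>i<n. ln (W (c m ! i) (ys ! i)))"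
      using chan_n_exp_sum[of "c m" W ys] supp[OF m] mA(2)[OF m(1)] by simp
    have 2: "chan_n U (c m) ys = exp (\<Sum>i<n. ln (U (c m ! i) (ys ! i)))"
      using chan_n_exp_sum[of "c m" U ys] supp[OF m] mA(2)[OF m(1)] by simp
    have "(\<Sum>i<n. ?g1 (c m ! i) (ys ! i)) = (\<Sum>i<n. ln (U (c m ! i) (ys ! i)) - ln (W (c m ! i) (ys ! i)))"
      by (rule sum.cong) (use supp[OF m] in \<open>auto simp: ln_div less_imp_neq[symmetric]\<close>)
    then have "(\<Sum>i<n. ln (U (c m ! i) (ys ! i))) - (\<Sum>i<n. ln (W (c m ! i) (ys ! i))) \<le> real n * (D + \<epsilon>)"
      using typ_le[OF m(2), of ?g1] by (simp add: D sum_subtractf algebra_simps)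
    then show ?thesis
      unfolding 1 2 exp_add[symmetric] by (simp add: algebra_simps)
  qed
  have chQ: "exp (- real n * (H + \<epsilon>)) \<le> chan_n (\<lambda>_. ?Q) (c m) ys" if m: "m \<in> A" "ys \<in> G m" for m ys
  proof -
    have "chan_n (\<lambda>_. ?Q) (c m) ys = exp (\<Sum>i<n. ln (?Q (ys ! i)))"
      using chan_n_exp_sum[of "c m" "\<lambda>_. ?Q" ys] supp[OF m] mA(2)[OF m(1)] by simp
    then show ?thesis
      using typ_le[OF m(2), of ?g3] by (simp add: H_def mean_uminus algebra_simps)
  qed
  have half: "1 / 2 \<le> (\<Sum>ys\<in>G m. chan_n U (c m) ys)" if m: "m \<in> A" for m
  proof -
    define bad where "bad = (\<lambda>g. {ys\<in>seqs. real n * \<epsilon> \<le> \<bar>(\<Sum>i<n. g (c m ! i) (ys ! i)) - real n * mean P U g\<bar>})"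
    define Z where "Z = {ys\<in>seqs. chan_n U (c m) ys = 0}"
    have bad: "sum (chan_n U (c m)) (bad g) \<le> 1 / 6"
      if "mean P U (\<lambda>a b. (g a b)\<^sup>2) \<le> var_bound W" for g
      using chebyshev_codeword[OF U mA(1)[OF m], of g, OF _ \<epsilon>] that mA(3)[OF m] by (simp add: bad_def)
    have fin: "finite (bad g)" "finite (G m)" "finite Z" for g
      using finite_subset[OF Gseqs finite_seqs'] by (auto simp: bad_def Z_def)
    \<comment> \<open>Outside \<open>G m\<close> lie only a null set and three Chebyshev sets of
      probability at most 1/6 each.\<close>
    have cover: "seqs \<subseteq> G m \<union> Z \<union> bad ?g1 \<union> bad ?g2 \<union> bad ?g3"
      by (auto simp: G_def Z_def bad_def typical_def)
    have un: "sum (chan_n U (c m)) (S \<union> T) \<le> sum (chan_n U (c m)) S + sum (chan_n U (c m)) T"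
      if "finite S" "finite T" for S T
      using sum.union_inter[OF that, of "chan_n U (c m)"] sum_nonneg[of "S \<inter> T" "chan_n U (c m)"]
        chan_n_nonneg[OF U, of "c m"] by simp
    have "1 = sum (chan_n U (c m)) seqs"
      using sum_chan_n[OF U, of "c m"] mA[OF m] by (simp add: seqs_def)
    also have "\<dots> \<le> sum (chan_n U (c m)) (G m \<union> Z \<union> bad ?g1 \<union> bad ?g2 \<union> bad ?g3)"
      by (rule sum_mono2[OF _ cover]) (use fin chan_n_nonneg[OF U] in auto)
    also have "\<dots> \<le> sum (chan_n U (c m)) (G m) + sum (chan_n U (c m)) Z
        + sum (chan_n U (c m)) (bad ?g1) + sum (chan_n U (c m)) (bad ?g2) + sum (chan_n U (c m)) (bad ?g3)"
      using un[of "G m \<union> Z \<union> bad ?g1 \<union> bad ?g2" "bad ?g3"] un[of "G m \<union> Z \<union> bad ?g1" "bad ?g2"]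
        un[of "G m \<union> Z" "bad ?g1"] un[of "G m" Z] fin by (simp del: Un_assoc)
    also have "sum (chan_n U (c m)) Z = 0" by (simp add: Z_def)
    finally show ?thesis
      using bad[of ?g1] bad[of ?g2] bad[of ?g3] var_bounds[OF P U W ac] by simp
  qed

  \<comment> \<open>The good outputs are counted through the product output law, under which each
    has probability at least exp (-n (H + \<epsilon>)). Again \<open>c m0\<close> only fixes the
    length.\<close>
  define Y where "Y = (\<Union>m\<in>A. G m)"
  have Yseqs: "Y \<subseteq> seqs" using Gseqs by (auto simp: Y_def)
  have finY: "finite Y" using Yseqs finite_subset finite_seqs' by blast
  obtain m0 where m0: "m0 \<in> A" using A by auto
  have Q: "is_channel (\<lambda>_::'a. ?Q)"
    using is_dist_out_dist[OF P U] by (simp add: is_channel_def)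
  have "real (card Y) * exp (- real n * (H + \<epsilon>)) = (\<Sum>y\<in>Y. exp (- real n * (H + \<epsilon>)))" by simp
  also have "\<dots> \<le> (\<Sum>y\<in>Y. chan_n (\<lambda>_. ?Q) (c m0) y)"
  proof (rule sum_mono)
    fix y assume "y \<in> Y"
    then obtain m where m: "m \<in> A" "y \<in> G m" by (auto simp: Y_def)
    then have "chan_n (\<lambda>_. ?Q) (c m0) y = chan_n (\<lambda>_. ?Q) (c m) y"
      using mA(2)[OF m(1)] mA(2)[OF m0] by (simp add: chan_n_def)
    then show "exp (- real n * (H + \<epsilon>)) \<le> chan_n (\<lambda>_. ?Q) (c m0) y" using chQ[OF m] by simp
  qed
  also have "\<dots> \<le> 1"
    using Yseqs mA(2)[OF m0] by (intro sum_chan_n_le_1[OF Q]) (auto simp: seqs_def)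
  finally have cardY: "real (card Y) \<le> exp (real n * (H + \<epsilon>))"
    unfolding mult_minus_left exp_minus by (simp add: field_simps)

  \<comment> \<open>For a given output only the codewords that find it typical are kept, so the
    logarithmic bound applies with success probability exp (-n (B - \<epsilon>)). Discarding the
    other messages can only lower the number of losing copies.\<close>
  define Ay where "Ay = (\<lambda>y. {m\<in>A. y \<in> G m})"
  have AyM: "Ay y \<subseteq> {..<M}" for y using AM by (auto simp: Ay_def)
  define E where "E = (real n * R + 2) * exp (real n * max 0 (K - (B - \<epsilon>)))"
  have ge: "real L * (\<Sum>m\<in>Ay y. chan_n W (c m) y) - E
      \<le> expect (\<lambda>Y. (\<Sum>m<M. real (copies L Y m y)) - mx {..<M} y Y)" if y: "y \<in> Y" for y
  proof -
    have ys: "y \<in> seqs" using y Yseqs by auto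
    have "expect (mx (Ay y) y) \<le> ln (real M) + 2 * real L * exp (- real n * (B - \<epsilon>))"
      by (rule expect_mx_le_log[OF AyM ys]) (use chW in \<open>auto simp: Ay_def\<close>)
    also have "\<dots> \<le> E" unfolding E_def by (rule log_bound)
    finally have "real L * (\<Sum>m\<in>Ay y. chan_n W (c m) y) - E
        \<le> expect (\<lambda>Y. (\<Sum>m\<in>Ay y. real (copies L Y m y)) - mx (Ay y) y Y)"
      by (simp add: expect_diff expect_sum_copies[OF AyM ys])
    also have "\<dots> \<le> expect (\<lambda>Y. (\<Sum>m<M. real (copies L Y m y)) - mx {..<M} y Y)"
      by (intro expect_mono sum_copies_minus_mx_mono AyM) auto
    finally show ?thesis .
  qed
  have nonneg: "0 \<le> expect (\<lambda>Y. (\<Sum>m<M. real (copies L Y m y)) - mx {..<M} y Y)" for y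
    unfolding expect_def
    by (intro sum_nonneg mult_nonneg_nonneg inst_prob_nonneg) (simp add: mx_le_sum)
  have "real L * real (card A) * exp (- real n * (D + \<epsilon>)) / 2
      = (\<Sum>m\<in>A. real L * exp (- real n * (D + \<epsilon>)) * (1 / 2))" by simp
  also have "\<dots> \<le> (\<Sum>m\<in>A. real L * exp (- real n * (D + \<epsilon>)) * (\<Sum>y\<in>G m. chan_n U (c m) y))"
    by (intro sum_mono mult_left_mono half) auto
  also have "\<dots> = (\<Sum>m\<in>A. \<Sum>y\<in>G m. real L * (chan_n U (c m) y * exp (- real n * (D + \<epsilon>))))"
    by (simp add: sum_distrib_left sum_distrib_right mult_ac)
  also have "\<dots> \<le> (\<Sum>m\<in>A. \<Sum>y\<in>G m. real L * chan_n W (c m) y)"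
    by (intro sum_mono mult_left_mono chU) auto
  also have "\<dots> = (\<Sum>m\<in>A. \<Sum>y\<in>{y\<in>Y. y \<in> G m}. real L * chan_n W (c m) y)"
    by (intro sum.cong refl) (auto simp: Y_def)
  also have "\<dots> = (\<Sum>y\<in>Y. \<Sum>m\<in>Ay y. real L * chan_n W (c m) y)"
    unfolding Ay_def by (rule sum.swap_restrict[OF finA finY])
  also have "\<dots> = (\<Sum>y\<in>Y. real L * (\<Sum>m\<in>Ay y. chan_n W (c m) y) - E) + real (card Y) * E"
    by (simp add: sum_subtractf sum_distrib_left)
  also have "(\<Sum>y\<in>Y. real L * (\<Sum>m\<in>Ay y. chan_n W (c m) y) - E)
      \<le> (\<Sum>y\<in>Y. expect (\<lambda>Y. (\<Sum>m<M. real (copies L Y m y)) - mx {..<M} y Y))"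
    by (intro sum_mono ge)
  also have "\<dots> \<le> (\<Sum>y\<in>seqs. expect (\<lambda>Y. (\<Sum>m<M. real (copies L Y m y)) - mx {..<M} y Y))"
    by (intro sum_mono2 Yseqs nonneg) auto
  also have "\<dots> = (1 - correct) * (real M * real L)"
    using M L by (simp add: one_minus_correct)
  finally have main: "real L * real (card A) * exp (- real n * (D + \<epsilon>)) / 2
      \<le> (1 - correct) * (real M * real L) + real (card Y) * E" by simp

  have "0 \<le> E" using R by (simp add: E_def)
  have "real (card Y) * E / (real M * real L) \<le> exp (real n * (H + \<epsilon>)) * E * (1 / (real M * real L))"
    using cardY \<open>0 \<le> E\<close> by (simp add: divide_right_mono mult_right_mono)
  also have "\<dots> \<le> exp (real n * (H + \<epsilon>)) * E * (4 * exp (- real n * (R + K)))"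
    using \<open>0 \<le> E\<close> by (intro mult_left_mono inverse_M_L) auto
  also have "\<dots> = 4 * (real n * R + 2) * (exp (real n * (H + \<epsilon>)) * exp (real n * max 0 (K - (B - \<epsilon>)))
       * exp (- real n * (R + K)))"
    by (simp add: E_def)
  also have "exp (real n * (H + \<epsilon>)) * exp (real n * max 0 (K - (B - \<epsilon>))) * exp (- real n * (R + K))
      = exp (real n * (H + \<epsilon> + max 0 (K - (B - \<epsilon>)) - (R + K)))"
    by (simp add: exp_add[symmetric] algebra_simps)
  also have "4 * (real n * R + 2) * \<dots> \<le> 4 * (real n * R + 2) * exp (- real n * (D + 3 * \<epsilon>))"
  proof -
    \<comment> \<open>Of the margin 5 \<epsilon>, one \<epsilon> pays for the number of outputs and
      one for the bound on the \<open>W\<close>-probability; the remaining three exceed the single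
      \<epsilon> lost in the main term.\<close>
    have "H + \<epsilon> + max 0 (K - (B - \<epsilon>)) - (R + K) \<le> - (D + 3 * \<epsilon>)"
      using feas \<epsilon>(1) unfolding H I_def[symmetric] B_def[symmetric] by (simp add: max_def split: if_splits)
    then have "real n * (H + \<epsilon> + max 0 (K - (B - \<epsilon>)) - (R + K)) \<le> - real n * (D + 3 * \<epsilon>)"
      unfolding mult_minus_left mult_minus_right[symmetric] by (rule mult_left_mono) simp
    then show ?thesis using R by (intro mult_left_mono iffD2[OF exp_le_cancel_iff]) auto
  qed
  finally have small: "real (card Y) * E / (real M * real L) \<le> 4 * (real n * R + 2) * exp (- real n * (D + 3 * \<epsilon>))" .
  have "real (card A) / real M * exp (- real n * (D + \<epsilon>)) / 2
      = (real L * real (card A) * exp (- real n * (D + \<epsilon>)) / 2) / (real M * real L)"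
    using L by (simp add: field_simps)
  also have "\<dots> \<le> ((1 - correct) * (real M * real L) + real (card Y) * E) / (real M * real L)"
    using main by (intro divide_right_mono) auto
  also have "\<dots> = (1 - correct) + real (card Y) * E / (real M * real L)"
    using M L by (simp add: add_divide_distrib)
  finally show ?thesis using small by linarith
qed

text \<open>Pigeonhole principle over the polynomially many input types.\<close>

lemma populous_type:
  obtains P where "is_dist P" "{m. m < M \<and> emp (c m) = P} \<noteq> {}"
    "real M \<le> (real n + 1) ^ card (UNIV :: 'a set) * real (card {m. m < M \<and> emp (c m) = P})"
proof -
  let ?A = "\<lambda>P. {m. m < M \<and> emp (c m) = P}"
  let ?T = "types n :: ('a \<Rightarrow> real) set"
  let ?k = "card (UNIV :: 'a set)"
  have "\<exists>P. real M \<le> (real n + 1) ^ ?k * real (card (?A P))"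
  proof (rule ccontr)
    assume "\<not> ?thesis"
    then have less: "(real n + 1) ^ ?k * real (card (?A P)) < real M" for P by (simp add: not_le)
    have ne: "?T \<noteq> {}" using len[OF M] by (auto simp: types_def)
    have "{..<M} = (\<Union>P\<in>?T. ?A P)" using len by (auto simp: types_def)
    then have "card {..<M} \<le> (\<Sum>P\<in>?T. card (?A P))"
      using card_UN_le[of ?T ?A] by simp
    then have "real M \<le> (\<Sum>P\<in>?T. real (card (?A P)))"
      by (simp flip: of_nat_sum)
    then have "(real n + 1) ^ ?k * real M \<le> (\<Sum>P\<in>?T. (real n + 1) ^ ?k * real (card (?A P)))"
      by (simp add: sum_distrib_left[symmetric] mult_left_mono)
    also have "\<dots> < (\<Sum>P\<in>?T. real M)"
      by (rule sum_strict_mono) (use ne less in auto)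
    also have "\<dots> \<le> (real n + 1) ^ ?k * real M"
    proof -
      have "real (card ?T) \<le> real ((n + 1) ^ ?k)" using card_types by (simp only: of_nat_le_iff)
      then show ?thesis by (auto intro!: mult_right_mono simp: add.commute)
    qed
    finally show False by simp
  qed
  then obtain P where P: "real M \<le> (real n + 1) ^ ?k * real (card (?A P))" by blast
  have ne: "?A P \<noteq> {}"
  proof
    assume e: "?A P = {}"
    from P show False unfolding e using M by simp
  qed
  then obtain m where m: "m < M" "emp (c m) = P" by auto
  then have "c m \<noteq> []" using len n by fastforce
  then have "is_dist P" using is_dist_emp m by blast
  then show ?thesis using that P ne by blast
qed

text \<open>The codebook determines its most frequent type, so a suitable \<open>U\<close> is
  required for every \<open>P\<close>; this is where the maximum over \<open>P\<close> in
  \<open>E_e\<close> enters.\<close>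

lemma one_minus_correct_ge_exp:
  assumes \<epsilon>: "\<epsilon> > 0" "6 * var_bound W \<le> real n * \<epsilon>\<^sup>2"
    and poly: "16 * (R + 2) * (real n + 1) ^ (card (UNIV :: 'a set) + 1) \<le> exp (real n * \<epsilon>)"
    and U: "\<And>P. is_dist P \<Longrightarrow> \<exists>U. is_channel U \<and> abs_cont P U W \<and>
       mut_inf P U + max 0 (mean P U (\<lambda>a b. - ln (W a b)) - K) \<le> R - 5 * \<epsilon> \<and>
       mean P U (\<lambda>a b. ln (U a b / W a b)) \<le> d"
  shows "exp (- real n * (d + 2 * \<epsilon>)) \<le> 1 - correct"
proof -
  obtain P where P: "is_dist P" and A0: "{m. m < M \<and> emp (c m) = P} \<noteq> {}"
    and big: "real M \<le> (real n + 1) ^ card (UNIV :: 'a set) * real (card {m. m < M \<and> emp (c m) = P})"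
    by (rule populous_type)
  define A where "A = {m. m < M \<and> emp (c m) = P}"
  from U[OF P] obtain U where U: "is_channel U" "abs_cont P U W"
    "mut_inf P U + max 0 (mean P U (\<lambda>a b. - ln (W a b)) - K) \<le> R - 5 * \<epsilon>"
    "mean P U (\<lambda>a b. ln (U a b / W a b)) \<le> d" by blast
  define D where "D = mean P U (\<lambda>a b. ln (U a b / W a b))"
  \<comment> \<open>\<open>q\<close> is the pigeonhole loss and \<open>x\<close> is one factor exp
    (-n \<epsilon>). The main term is at least z / (2 q), the subtracted one at most z / (4 q)
    because 16 (n R + 2) q x <= 1, and the remaining z / (4 q) is at least z x.\<close>
  define q where "q = (real n + 1) ^ card (UNIV :: 'a set)"
  define x where "x = exp (- real n * \<epsilon>)"
  define z where "z = exp (- real n * (D + \<epsilon>))"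
  have q: "1 \<le> q" unfolding q_def by (rule one_le_power) simp
  have x: "0 < x" "x \<le> 1" using \<epsilon> by (auto simp: x_def)
  have z: "0 < z" by (simp add: z_def)
  have ge: "real (card A) / real M * z / 2 - 4 * (real n * R + 2) * exp (- real n * (D + 3 * \<epsilon>)) \<le> 1 - correct"
    unfolding z_def using A0 by (intro one_minus_correct_ge[OF P U(1,2) \<epsilon> U(3) A_def _ D_def]) (simp add: A_def)
  have e3: "exp (- real n * (D + 3 * \<epsilon>)) = z * x * x"
    by (simp add: z_def x_def exp_add[symmetric] algebra_simps)
  have "16 * (real n * R + 2) * q \<le> 16 * ((R + 2) * (real n + 1)) * q"
    using R q by (intro mult_right_mono mult_left_mono) (auto simp: algebra_simps)
  also have "\<dots> = 16 * (R + 2) * (real n + 1) ^ (card (UNIV :: 'a set) + 1)"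
    by (simp add: q_def)
  also have "\<dots> \<le> exp (real n * \<epsilon>)" by (rule poly)
  also have "\<dots> = 1 / x" by (simp add: x_def exp_minus divide_inverse)
  finally have qx: "16 * (real n * R + 2) * q * x \<le> 1" using x by (simp add: field_simps)
  have nR: "0 \<le> real n * R" using R by simp
  have fourqx: "4 * q * x \<le> 1"
  proof -
    have "4 * (q * x) \<le> 16 * (real n * R + 2) * (q * x)"
      using nR q x by (intro mult_right_mono) auto
    then show ?thesis using qx by (simp add: mult.assoc)
  qed
  have "1 / q \<le> real (card A) / real M"
    using big M q by (simp add: A_def q_def field_simps)
  then have "1 / q * z / 2 \<le> real (card A) / real M * z / 2"
    using z by (intro divide_right_mono mult_right_mono) auto
  moreover have "4 * (real n * R + 2) * (z * x * x) \<le> 1 / q * z / 4"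
  proof -
    have "16 * (real n * R + 2) * q * x * (x * z) \<le> 1 * (1 * z)"
      using qx x z nR q by (intro mult_mono) auto
    then show ?thesis using q by (simp add: field_simps)
  qed
  moreover have "z * x \<le> 1 / q * z / 4"
  proof -
    have "4 * q * x * z \<le> 1 * z" using fourqx z by (intro mult_right_mono) auto
    then show ?thesis using q by (simp add: field_simps)
  qed
  ultimately have "z * x \<le> 1 - correct" using ge e3 by simp
  moreover have "exp (- real n * (d + 2 * \<epsilon>)) \<le> z * x"
  proof -
    have "real n * D \<le> real n * d" using U(4) by (simp add: D_def mult_left_mono)
    then show ?thesis by (simp add: z_def x_def exp_add[symmetric] algebra_simps)
  qed
  ultimately show ?thesis by simp
qed

end

section \<open>Continuity of the error exponent from the left\<close>

text \<open>The function u ln (u / q) is convex and homogeneous of degree 1; the left side is its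
  supporting plane along the ray u / q = r. It reduces to ln t <= t - 1 at t = r q / u.\<close>

lemma tangent_le_mult_ln:
  fixes u q r :: real
  assumes "0 \<le> u" "0 \<le> q" "u \<noteq> 0 \<Longrightarrow> 0 < q" "0 < r"
  shows "u * ln r + u - r * q \<le> u * ln (u / q)"
proof (cases "u = 0")
  case False
  then have u: "0 < u" "0 < q" using assms by auto
  have "ln (r * q / u) \<le> r * q / u - 1"
    using u assms by (intro ln_le_minus_one) auto
  then have "u * ln (r * q / u) \<le> u * (r * q / u - 1)"
    using u by (intro mult_left_mono) auto
  then show ?thesis
    using u assms by (simp add: ln_div ln_mult algebra_simps)
qed (use assms in auto)

text \<open>A two-term log-sum inequality. The supporting plane is taken at the ratio r = u / q of
  the mixture: it is linear, lies below the function at both endpoints, and touches it at the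
  mixture.\<close>

lemma mult_ln_div_convex:
  fixes u0 u1 q0 q1 l :: real
  assumes u0: "0 \<le> u0" "0 \<le> q0" "u0 \<noteq> 0 \<Longrightarrow> 0 < q0" and u1: "0 \<le> u1" "0 \<le> q1" "u1 \<noteq> 0 \<Longrightarrow> 0 < q1"
    and l: "0 < l" "l < 1"
  defines "u \<equiv> l * u0 + (1 - l) * u1" and "q \<equiv> l * q0 + (1 - l) * q1"
  shows "u * ln (u / q) \<le> l * (u0 * ln (u0 / q0)) + (1 - l) * (u1 * ln (u1 / q1))"
proof (cases "u = 0")
  case True
  have "0 \<le> l * u0" "0 \<le> (1 - l) * u1" using u0 u1 l by auto
  then have "l * u0 = 0" "(1 - l) * u1 = 0" using True unfolding u_def by linarith+
  then show ?thesis using True l by simp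
next
  case False
  have "0 \<le> l * u0" "0 \<le> (1 - l) * u1" "0 \<le> l * q0" "0 \<le> (1 - l) * q1" using u0 u1 l by auto
  then have u: "0 < u" using False unfolding u_def by linarith
  have "u0 \<noteq> 0 \<or> u1 \<noteq> 0" using False by (auto simp: u_def)
  then have "0 < l * q0 \<or> 0 < (1 - l) * q1" using u0 u1 l by auto
  then have q: "0 < q" using \<open>0 \<le> l * q0\<close> \<open>0 \<le> (1 - l) * q1\<close> unfolding q_def by linarith
  define r where "r = u / q"
  have r: "0 < r" "r * q = u" using u q by (auto simp: r_def)
  have "l * (u0 * ln r + u0 - r * q0) + (1 - l) * (u1 * ln r + u1 - r * q1)
      \<le> l * (u0 * ln (u0 / q0)) + (1 - l) * (u1 * ln (u1 / q1))"
    using l by (intro add_mono mult_left_mono tangent_le_mult_ln[OF u0 r(1)] tangent_le_mult_ln[OF u1 r(1)]) auto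
  also have "l * (u0 * ln r + u0 - r * q0) + (1 - l) * (u1 * ln r + u1 - r * q1) = u * ln r + u - r * q"
    by (simp add: u_def q_def algebra_simps)
  finally show ?thesis using r by (simp add: r_def)
qed

definition mix :: "real \<Rightarrow> ('a \<Rightarrow> 'b \<Rightarrow> real) \<Rightarrow> ('a \<Rightarrow> 'b \<Rightarrow> real) \<Rightarrow> 'a \<Rightarrow> 'b \<Rightarrow> real" where
  "mix l U0 U1 a b = l * U0 a b + (1 - l) * U1 a b"

section \<open>Convexity under mixing of two channels\<close>

context
  fixes P :: "'a::finite \<Rightarrow> real" and U0 U1 :: "'a \<Rightarrow> 'b::finite \<Rightarrow> real" and l :: real
  assumes P: "is_dist P" and U0: "is_channel U0" and U1: "is_channel U1" and l: "0 < l" "l < 1"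
begin

lemma is_channel_mix: "is_channel (mix l U0 U1)"
  using U0 U1 l unfolding is_channel_def is_dist_def mix_def
  by (auto simp: sum.distrib simp flip: sum_distrib_left)

lemma out_dist_mix: "out_dist P (mix l U0 U1) b = l * out_dist P U0 b + (1 - l) * out_dist P U1 b"
  unfolding out_dist_def mix_def sum_distrib_left sum.distrib[symmetric]
  by (intro sum.cong) (auto simp: algebra_simps)

lemma mean_mix: "mean P (mix l U0 U1) f = l * mean P U0 f + (1 - l) * mean P U1 f"
  unfolding mean_def mix_def sum_distrib_left sum.distrib[symmetric]
  by (intro sum.cong) (auto simp: algebra_simps)

lemma abs_cont_mix:
  assumes "abs_cont P U0 W" "abs_cont P U1 W"
  shows "abs_cont P (mix l U0 U1) W"
  unfolding abs_cont_def
proof (intro allI impI notI)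
  fix a b assume ne: "P a * mix l U0 U1 a b \<noteq> 0" and "W a b = 0"
  then have "P a * U0 a b = 0" "P a * U1 a b = 0"
    using assms unfolding abs_cont_def by blast+
  with ne show False by (auto simp: mix_def)
qed

text \<open>Common source of two convexity statements: the output distributions as \<open>q0\<close>
  and \<open>q1\<close> give mutual information, and \<open>q0 = q1 = W\<close> gives divergence,
  since the mixed denominator is then \<open>W\<close> again.\<close>

lemma mean_ln_mix_le:
  assumes "\<And>a b. 0 \<le> q0 a b" "\<And>a b. P a * U0 a b \<noteq> 0 \<Longrightarrow> 0 < q0 a b"
    and "\<And>a b. 0 \<le> q1 a b" "\<And>a b. P a * U1 a b \<noteq> 0 \<Longrightarrow> 0 < q1 a b"
  shows "mean P (mix l U0 U1) (\<lambda>a b. ln (mix l U0 U1 a b / (l * q0 a b + (1 - l) * q1 a b)))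
    \<le> l * mean P U0 (\<lambda>a b. ln (U0 a b / q0 a b)) + (1 - l) * mean P U1 (\<lambda>a b. ln (U1 a b / q1 a b))"
  unfolding mean_def sum_distrib_left sum.distrib[symmetric]
proof (intro sum_mono)
  fix a b
  show "P a * mix l U0 U1 a b * ln (mix l U0 U1 a b / (l * q0 a b + (1 - l) * q1 a b))
    \<le> l * (P a * U0 a b * ln (U0 a b / q0 a b)) + (1 - l) * (P a * U1 a b * ln (U1 a b / q1 a b))"
  proof (cases "P a = 0")
    case False
    then have "0 < P a" using P by (simp add: is_dist_def less_le)
    have "mix l U0 U1 a b * ln (mix l U0 U1 a b / (l * q0 a b + (1 - l) * q1 a b))
      \<le> l * (U0 a b * ln (U0 a b / q0 a b)) + (1 - l) * (U1 a b * ln (U1 a b / q1 a b))"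
      unfolding mix_def
      by (rule mult_ln_div_convex) (use assms False l channel_nonneg[OF U0] channel_nonneg[OF U1] in auto)
    then have "P a * (mix l U0 U1 a b * ln (mix l U0 U1 a b / (l * q0 a b + (1 - l) * q1 a b)))
      \<le> P a * (l * (U0 a b * ln (U0 a b / q0 a b)) + (1 - l) * (U1 a b * ln (U1 a b / q1 a b)))"
      using \<open>0 < P a\<close> by (intro mult_left_mono) auto
    then show ?thesis by (simp add: algebra_simps)
  qed simp
qed

lemma mut_inf_mix: "mut_inf P (mix l U0 U1) \<le> l * mut_inf P U0 + (1 - l) * mut_inf P U1"
  unfolding mut_inf_eq out_dist_mix
  by (rule mean_ln_mix_le)
     (rule out_dist_nonneg[OF P U0] supp_pos(3)[OF P U0] out_dist_nonneg[OF P U1] supp_pos(3)[OF P U1]; assumption?)+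

lemma div_mix:
  assumes W: "is_channel W" and ac: "abs_cont P U0 W" "abs_cont P U1 W"
  shows "mean P (mix l U0 U1) (\<lambda>a b. ln (mix l U0 U1 a b / W a b))
    \<le> l * mean P U0 (\<lambda>a b. ln (U0 a b / W a b)) + (1 - l) * mean P U1 (\<lambda>a b. ln (U1 a b / W a b))"
proof -
  have "l * W a b + (1 - l) * W a b = W a b" for a b by (simp add: algebra_simps)
  then show ?thesis
    using mean_ln_mix_le[of W W] channel_nonneg[OF W] ac by (auto simp: abs_cont_def less_le)
qed

text \<open>The rate functional is convex in the channel: mutual information is convex for fixed
  \<open>P\<close>, and the positive part of an affine function is convex. Mixing with a channel
  feasible at a smaller rate therefore creates slack in the constraint.\<close>

lemma feasible_mix:
  fixes K :: real and f :: "'a \<Rightarrow> 'b \<Rightarrow> real"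
  defines "F \<equiv> \<lambda>U. mut_inf P U + max 0 (mean P U f - K)"
  assumes "F U0 \<le> R0" "F U1 \<le> R1"
  shows "F (mix l U0 U1) \<le> l * R0 + (1 - l) * R1"
proof -
  have l': "0 \<le> l" "0 \<le> 1 - l" using l by auto
  have "max 0 (mean P (mix l U0 U1) f - K) \<le> l * max 0 (mean P U0 f - K) + (1 - l) * max 0 (mean P U1 f - K)"
  proof (rule max.boundedI)
    show "0 \<le> l * max 0 (mean P U0 f - K) + (1 - l) * max 0 (mean P U1 f - K)"
      using l by (intro add_nonneg_nonneg mult_nonneg_nonneg) auto
    have "mean P (mix l U0 U1) f - K = l * (mean P U0 f - K) + (1 - l) * (mean P U1 f - K)"
      by (simp add: mean_mix algebra_simps)
    also have "\<dots> \<le> l * max 0 (mean P U0 f - K) + (1 - l) * max 0 (mean P U1 f - K)"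
      using l' by (intro add_mono mult_left_mono) auto
    finally show "mean P (mix l U0 U1) f - K \<le> l * max 0 (mean P U0 f - K) + (1 - l) * max 0 (mean P U1 f - K)" .
  qed
  then have "F (mix l U0 U1) \<le> l * F U0 + (1 - l) * F U1"
    using mut_inf_mix by (simp add: F_def algebra_simps)
  also have "\<dots> \<le> l * R0 + (1 - l) * R1"
    using l' assms by (intro add_mono mult_left_mono)
  finally show ?thesis .
qed

end

lemma E_e_antimono:
  assumes "R \<le> R'"
  shows "E_e W R' K \<le> E_e W R K"
  unfolding E_e_def
proof (rule SUP_mono)
  fix P :: "'a \<Rightarrow> real" assume "P \<in> {P. is_dist P}"
  moreover have "{U. is_channel U \<and> ereal (mut_inf P U) + posp (B_val P U W - ereal K) \<le> ereal R}
    \<subseteq> {U. is_channel U \<and> ereal (mut_inf P U) + posp (B_val P U W - ereal K) \<le> ereal R'}"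
    using assms by (auto intro: order_trans)
  ultimately show "\<exists>P'\<in>{P. is_dist P}. (INF U\<in>{U. is_channel U \<and> ereal (mut_inf P U) + posp (B_val P U W - ereal K) \<le> ereal R'}. cond_div U W P)
      \<le> (INF U\<in>{U. is_channel U \<and> ereal (mut_inf P' U) + posp (B_val P' U W - ereal K) \<le> ereal R}. cond_div U W P')"
    by (intro bexI[of _ P] INF_superset_mono) auto
qed

text \<open>Unfolds the supremum over \<open>P\<close> and the infimum over \<open>U\<close>; the
  strict inequality allows an actual channel to be extracted without the infimum being
  attained.\<close>

lemma E_e_less_imp:
  assumes "E_e W R K < ereal z" "is_dist P"
  obtains U where "is_channel U" "abs_cont P U W"
    "mut_inf P U + max 0 (mean P U (\<lambda>a b. - ln (W a b)) - K) \<le> R"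
    "mean P U (\<lambda>a b. ln (U a b / W a b)) \<le> z"
proof -
  let ?S = "{U. is_channel U \<and> ereal (mut_inf P U) + posp (B_val P U W - ereal K) \<le> ereal R}"
  have "(INF U\<in>?S. cond_div U W P) \<le> E_e W R K"
    unfolding E_e_def using assms(2) by (intro SUP_upper) auto
  then have "(INF U\<in>?S. cond_div U W P) < ereal z" using assms(1) by (rule le_less_trans)
  then obtain U where "U \<in> ?S" "cond_div U W P < ereal z" by (auto simp: INF_less_iff)
  then show ?thesis using that by (auto simp: feasible_iff cond_div_eq)
qed

lemma limsup_error:
  fixes W :: "'x::finite \<Rightarrow> 'y::finite \<Rightarrow> real"
  assumes W: "is_channel W" and R: "R > 0" and K: "K > 0" and jump: "\<not> jump_point W K R"
  shows "limsup (\<lambda>n. SUP c \<in> codebooks n (num_msgs n R). neglog_rate n (err_prob W n R K c)) \<le> E_e W R K"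
  unfolding Limsup_le_iff
proof (intro allI impI)
  fix x assume "E_e W R K < x"
  then obtain z' where z': "E_e W R K < ereal z'" "ereal z' < x" using ereal_dense2 by blast
  then obtain z where z: "E_e W R K < ereal z" "ereal z < ereal z'" using ereal_dense2 by blast
  define \<delta> where "\<delta> = z' - z"
  have \<delta>: "0 < \<delta>" using z by (simp add: \<delta>_def)
  \<comment> \<open>The exponent is finite at \<open>R\<close>, hence at all larger rates by
    monotonicity. Since \<open>R\<close> is no jump point, it must then also be finite at some
    smaller rate \<open>R0\<close>.\<close>
  have "E_e W R' K < \<infinity>" if "R' > R" for R'
    using E_e_antimono[of R R' W K] that z(1) by (meson ereal_infty_less(1) le_less_trans less_ereal.simps(4) less_imp_le less_trans)
  then obtain R0 where R0: "R0 < R" "E_e W R0 K \<noteq> \<infinity>"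
    using jump unfolding jump_point_def by auto
  then have "E_e W R0 K < \<infinity>" by simp
  then obtain z0 where z0: "E_e W R0 K < ereal z0" using ereal_dense2 by blast
  \<comment> \<open>The weight is small enough that mixing raises the divergence bound
    \<open>z\<close> by at most \<delta> / 2. The cap 1/2 keeps \<open>l < 1\<close>, and adding 1
    keeps the denominator positive.\<close>
  define l where "l = min (1 / 2) (\<delta> / 2 / (\<bar>z0 - z\<bar> + 1))"
  have "0 < \<delta> / 2 / (\<bar>z0 - z\<bar> + 1)" using \<delta> by (intro divide_pos_pos) auto
  then have l: "0 < l" "l < 1" by (auto simp: l_def min_less_iff_disj)
  have "l * (z0 - z) \<le> l * (\<bar>z0 - z\<bar> + 1)" using l by (intro mult_left_mono) auto
  also have "\<dots> \<le> \<delta> / 2 / (\<bar>z0 - z\<bar> + 1) * (\<bar>z0 - z\<bar> + 1)"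
    by (intro mult_right_mono) (auto simp: l_def)
  also have "\<dots> = \<delta> / 2"
    by (subst times_divide_eq_left, rule nonzero_mult_div_cancel_right) linarith
  finally have lz: "l * z0 + (1 - l) * z \<le> z + \<delta> / 2" by (simp add: algebra_simps)
  \<comment> \<open>The first term keeps the loss 2 \<epsilon> in the exponent below the other half
    of \<delta>; the second makes 5 \<epsilon> fit into the rate slack \<open>l * (R - R0)\<close>
    gained by mixing.\<close>
  define \<epsilon> where "\<epsilon> = min (\<delta> / 4) (l * (R - R0) / 5)"
  have \<epsilon>: "0 < \<epsilon>" using \<delta> l R0 by (auto simp: \<epsilon>_def)
  have lR: "l * R0 + (1 - l) * R \<le> R - 5 * \<epsilon>"
  proof -
    have "5 * \<epsilon> \<le> l * (R - R0)" by (simp add: \<epsilon>_def)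
    then show ?thesis by (simp add: algebra_simps)
  qed
  have U: "\<exists>U. is_channel U \<and> abs_cont P U W \<and>
       mut_inf P U + max 0 (mean P U (\<lambda>a b. - ln (W a b)) - K) \<le> R - 5 * \<epsilon> \<and>
       mean P U (\<lambda>a b. ln (U a b / W a b)) \<le> z + \<delta> / 2" if P: "is_dist P" for P
  proof -
    obtain U0 where U0: "is_channel U0" "abs_cont P U0 W"
      "mut_inf P U0 + max 0 (mean P U0 (\<lambda>a b. - ln (W a b)) - K) \<le> R0"
      "mean P U0 (\<lambda>a b. ln (U0 a b / W a b)) \<le> z0"
      by (rule E_e_less_imp[OF z0 P])
    obtain U1 where U1: "is_channel U1" "abs_cont P U1 W"
      "mut_inf P U1 + max 0 (mean P U1 (\<lambda>a b. - ln (W a b)) - K) \<le> R"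
      "mean P U1 (\<lambda>a b. ln (U1 a b / W a b)) \<le> z"
      by (rule E_e_less_imp[OF z(1) P])
    let ?U = "mix l U0 U1"
    have "mean P ?U (\<lambda>a b. ln (?U a b / W a b))
      \<le> l * mean P U0 (\<lambda>a b. ln (U0 a b / W a b)) + (1 - l) * mean P U1 (\<lambda>a b. ln (U1 a b / W a b))"
      by (rule div_mix[OF P U0(1) U1(1) l W U0(2) U1(2)])
    also have "\<dots> \<le> l * z0 + (1 - l) * z"
      using l U0(4) U1(4) by (intro add_mono mult_left_mono) auto
    also note lz
    finally have "mean P ?U (\<lambda>a b. ln (?U a b / W a b)) \<le> z + \<delta> / 2" .
    moreover have "mut_inf P ?U + max 0 (mean P ?U (\<lambda>a b. - ln (W a b)) - K) \<le> R - 5 * \<epsilon>"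
      using feasible_mix[OF P U0(1) U1(1) l U0(3) U1(3)] lR by linarith
    ultimately show ?thesis
      using is_channel_mix[OF P U0(1) U1(1) l] abs_cont_mix[OF P U0(1) U1(1) l U0(2) U1(2)] by blast
  qed
  \<comment> \<open>Both thresholds on the block length are independent of the codebook, so the
    estimate passes to the supremum over codebooks.\<close>
  have "\<forall>\<^sub>F n in sequentially. 6 * var_bound W / \<epsilon>\<^sup>2 \<le> real n"
    using filterlim_real_sequentially unfolding filterlim_at_top by blast
  moreover have "\<forall>\<^sub>F n in sequentially. 16 * (R + 2) * (real n + 1) ^ (card (UNIV :: 'x set) + 1) < exp (real n * \<epsilon>)"
    by (rule eventually_poly_less_exp[OF \<epsilon>])
  ultimately show "\<forall>\<^sub>F n in sequentially.
      (SUP c \<in> codebooks n (num_msgs n R). neglog_rate n (err_prob W n R K c)) < x"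
    using eventually_gt_at_top[of 0]
  proof eventually_elim
    case (elim n)
    have "neglog_rate n (err_prob W n R K c) \<le> ereal z'" if c: "c \<in> codebooks n (num_msgs n R)" for c
    proof -
      interpret rate_code W n "num_msgs n R" "num_msgs n K" c R K
        by (rule rate_code_codebooks) (use W R K c elim in auto)
      let ?e = "err_prob W n R K c"
      have err: "?e = 1 - correct"
        by (rule err_prob_eq[OF cloud_code_axioms])
      have "exp (- real n * (z + \<delta> / 2 + 2 * \<epsilon>)) \<le> 1 - correct"
        by (rule one_minus_correct_ge_exp[OF \<epsilon> _ _ U]) (use elim \<epsilon> in \<open>auto simp: field_simps\<close>)
      then have ge: "exp (- real n * (z + \<delta> / 2 + 2 * \<epsilon>)) \<le> ?e" unfolding err .
      then have pos: "0 < ?e" using exp_gt_zero less_le_trans by blast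
      have "- real n * (z + \<delta> / 2 + 2 * \<epsilon>) \<le> ln ?e"
        using ge pos by (simp add: ln_ge_iff)
      then have "- ln ?e / real n \<le> z + \<delta> / 2 + 2 * \<epsilon>"
        using elim by (subst pos_divide_le_eq) (auto simp: mult.commute)
      also have "\<dots> \<le> z'"
      proof -
        have "\<epsilon> \<le> \<delta> / 4" unfolding \<epsilon>_def by simp
        then have "2 * \<epsilon> \<le> \<delta> / 2" by simp
        moreover have "z + \<delta> / 2 + \<delta> / 2 = z'" by (simp add: \<delta>_def)
        ultimately show ?thesis by linarith
      qed
      finally show ?thesis using pos by (simp add: neglog_rate_def)
    qed
    then have "(SUP c \<in> codebooks n (num_msgs n R). neglog_rate n (err_prob W n R K c)) \<le> ereal z'"
      by (rule SUP_least)
    then show ?case using z' by simp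
  qed
qed

theorem theorem2:
  fixes W :: "'x::finite \<Rightarrow> 'y::finite \<Rightarrow> real" and R K :: real
  assumes "is_channel W" and "R > 0" and "K > 0"
  shows "liminf (\<lambda>n. INF c \<in> codebooks n (num_msgs n R).
            neglog_rate n (1 - err_prob W n R K c)) \<ge> E_c W R K
         \<and> (\<not> jump_point W K R \<longrightarrow>
         limsup (\<lambda>n. SUP c \<in> codebooks n (num_msgs n R).
            neglog_rate n (err_prob W n R K c)) \<le> E_e W R K)"
  using liminf_correct[OF assms] limsup_error[OF assms] by blast

end
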